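(* Let $\Gamma$, $D$, $q$, $H$, the vector space $\Lambda$ and the maps $A^{(1)},A^{(2)},A^{(3)},A^{*(1)},A^{*(2)},A^{*(3)}$ be as described in the context. The vector space $\Lambda$ becomes a $U'_q(\mathfrak{so}_6)$-module on which \[ B_1=\frac{A^{(1)}}{H(q^2-q^{-2})},\qquad B_3=\frac{A^{(2)}}{H(q^2-q^{-2})},\qquad B_5=\frac{A^{(3)}}{H(q^2-q^{-2})}, \] \[ B_2=\frac{A^{*(3)}}{H(q^{-2}-q^{2})},\qquad B_4=\frac{A^{*(1)}}{H(q^{-2}-q^{2})},\qquad B_6=\frac{A^{*(2)}}{H(q^{-2}-q^{2})}. \]
   Context: GRAPH SETTING. $\Gamma=(X,\mathcal R)$ is a finite undirected connected graph without loops or multiple edges, with vertex set $X$, $|X|\ge 2$, path-length distance $\partial$ and diameter $D=\max\{\partial(x,y)\mid x,y\in X\}$. Write $\Gamma_i(x)=\{y\in X\mid\partial(x,y)=i\}$ and $\Gamma(x)=\Gamma_1(x)$. $\Gamma$ is distance-regular: for $0\le h,i,j\le D$ and $\partial(x,y)=h$, the number $p^h_{i,j}=|\Gamma_i(x)\cap\Gamma_j(y)|$ depends only on $h,i,j$. Put $c_i=p^i_{1,i-1}$, $a_i=p^i_{1,i}$, $b_i=p^i_{1,i+1}$ ($c_0=0$, $b_D=0$), $k_i=p^0_{i,i}$. $V$ is the complex vector space with basis $X$. For $0\le i\le D$, $A_i\in\mathrm{End}(V)$ sends $x\mapsto\sum_{\xi\in\Gamma_i(x)}\xi$; $A=A_1$.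 The $A_i$ form a basis of a commutative algebra $M\subseteq\mathrm{End}(V)$ generated by $A$. The primitive idempotents $E_0,\dots,E_D$ are the basis of $M$ with $E_iE_j=\delta_{i,j}E_i$, $\sum_iE_i=I$, $E_0=|X|^{-1}\sum_iA_i$. The Krein parameters $q^h_{i,j}$ are given by $E_i\circ E_j=|X|^{-1}\sum_hq^h_{i,j}E_h$, where $\circ$ is the entrywise product of matrices with respect to the basis $X$. The ordering $E_0,\dots,E_D$ is $Q$-polynomial if for all $0\le h,i,j\le D$: $q^h_{i,j}=0$ when one of $h,i,j$ exceeds the sum of the other two, and $q^h_{i,j}\ne0$ when one of them equals the sum of the other two; $\Gamma$ is $Q$-polynomial if such an ordering exists. $\theta_i$ is defined by $AE_i=\theta_iE_i$, and $\theta^*_i$ by $E_1=|X|^{-1}\sum_{i=0}^D\theta^*_iA_i$. $\Gamma$ is bipartite if $a_i=0$ for all $i$; a bipartite $\Gamma$ is called 2-homogeneous if $k_D=1$ (antipodal 2-cover) and $\Gamma$ is $Q$-polynomial. ASSUMPTION. $D\ge3$, $\Gamma$ is 2-homogeneous bipartite, not a hypercube and not a cycle, and $\{E_i\}_{i=0}^D$ is a fixed $Q$-polynomial ordering. Then there is a nonzero $q\in\mathbb C$, not a root of unity, which we fix, such that for $0\le i\le D$: $\theta_i=\theta^*_i=H\sqrt{-1}\,(q^{D-2i}-q^{2i-D})$, $c_i=H\sqrt{-1}\,\frac{q^{2i}-q^{-2i}}{q^{D-2i}+q^{2i-D}}$, $b_i=H\sqrt{-1}\,\frac{q^{2D-2i}-q^{2i-2D}}{q^{D-2i}+q^{2i-D}}$,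 where $H=\sqrt{-1}\,\frac{q^{D-2}+q^{2-D}}{q^{-2}-q^{2}}$. THE SPACE $\Lambda$ AND THE SIX MAPS. $V^{\otimes3}=V\otimes V\otimes V$. $\mathcal P_D$ is the set of $(r,s,t,u)\in\mathbb N^4$ ($0\in\mathbb N$) with $r+s+t+u=D$. Every $x,y,z\in X$ have a unique profile $(r,s,t,u)\in\mathcal P_D$, determined by $\partial(x,y)=s+t$, $\partial(y,z)=t+u$, $\partial(z,x)=u+s$. For $(r,s,t,u)\in\mathcal P_D$, $B(r,s,t,u)=\sum x\otimes y\otimes z$ over all triples $x,y,z\in X$ of profile $(r,s,t,u)$. $\Lambda$ is the subspace of $V^{\otimes3}$ with basis $\{B(r,s,t,u)\}_{(r,s,t,u)\in\mathcal P_D}$. The maps in $\mathrm{End}(V^{\otimes3})$ are, for $x,y,z\in X$: $A^{(1)}(x\otimes y\otimes z)=\sum_{\xi\in\Gamma(x)}\xi\otimes y\otimes z$, $A^{(2)}(x\otimes y\otimes z)=\sum_{\xi\in\Gamma(y)}x\otimes\xi\otimes z$, $A^{(3)}(x\otimes y\otimes z)=\sum_{\xi\in\Gamma(z)}x\otimes y\otimes\xi$, $A^{*(1)}(x\otimes y\otimes z)=\theta^*_{\partial(y,z)}x\otimes y\otimes z$, $A^{*(2)}(x\otimes y\otimes z)=\theta^*_{\partial(z,x)}x\otimes y\otimes z$, $A^{*(3)}(x\otimes y\otimes z)=\theta^*_{\partial(x,y)}x\otimes y\otimes z$. All six leave $\Lambda$ invariant, and in the claim they denote the restrictions to $\Lambda$.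 THE ALGEBRA $U'_q(\mathfrak{so}_6)$. It is the associative unital complex algebra with generators $B_1,\dots,B_5$ and relations: $B_i^2B_j-(q^2+q^{-2})B_iB_jB_i+B_jB_i^2=-B_j$ if $|i-j|=1$; $B_iB_j=B_jB_i$ if $|i-j|\ge2$. With $[R,S]_q=qRS-q^{-1}SR$, the element $B_6$ is defined by $B_6=-[B_1,[B_2,[B_3,[B_4,B_5]_q]_q]_q]_q$. *)

theory Defs
  imports
    "HOL-Analysis.Analysis"
    "HOL-Algebra.QuotRing"
    "HOL-Library.Poly_Mapping"
begin

section \<open>Distance-regular graphs\<close>

text \<open>
  A graph is given by its adjacency relation; the vertex set \<open>X\<close> is a finite type.
\<close>

definition connected_simple_graph :: "('a::finite \<Rightarrow> 'a \<Rightarrow> bool) \<Rightarrow> bool" where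
  "connected_simple_graph adj \<longleftrightarrow>
     CARD('a) \<ge> 2 \<and> symp adj \<and> irreflp adj \<and> (\<forall>x y. adj\<^sup>*\<^sup>* x y)"

text \<open>The minimal length of a walk from \<open>x\<close> to \<open>y\<close>, i.e. the path-length distance.\<close>

definition gdist :: "('a \<Rightarrow> 'a \<Rightarrow> bool) \<Rightarrow> 'a \<Rightarrow> 'a \<Rightarrow> nat" where
  "gdist adj x y = (LEAST n. (adj ^^ n) x y)"

definition graph_diameter :: "('a::finite \<Rightarrow> 'a \<Rightarrow> bool) \<Rightarrow> nat" where
  "graph_diameter adj = Max {gdist adj x y |x y. True}"

definition sphere_at :: "('a \<Rightarrow> 'a \<Rightarrow> bool) \<Rightarrow> nat \<Rightarrow> 'a \<Rightarrow> 'a set" where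
  "sphere_at adj i x = {y. gdist adj x y = i}"

definition distance_regular :: "('a::finite \<Rightarrow> 'a \<Rightarrow> bool) \<Rightarrow> bool" where
  "distance_regular adj \<longleftrightarrow> connected_simple_graph adj \<and>
     (\<forall>h\<le>graph_diameter adj. \<forall>i\<le>graph_diameter adj. \<forall>j\<le>graph_diameter adj. \<forall>x y x' y'.
        gdist adj x y = h \<longrightarrow> gdist adj x' y' = h \<longrightarrow>
        card (sphere_at adj i x \<inter> sphere_at adj j y) =
        card (sphere_at adj i x' \<inter> sphere_at adj j y'))"

text \<open>\<open>p_num adj h i j\<close> is the intersection number with upper index \<open>h\<close>.\<close>

definition p_num :: "('a::finite \<Rightarrow> 'a \<Rightarrow> bool) \<Rightarrow> nat \<Rightarrow> nat \<Rightarrow> nat \<Rightarrow> nat" where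
  "p_num adj h i j = (THE n. \<forall>x y. gdist adj x y = h \<longrightarrow>
     card (sphere_at adj i x \<inter> sphere_at adj j y) = n)"

definition c_num :: "('a::finite \<Rightarrow> 'a \<Rightarrow> bool) \<Rightarrow> nat \<Rightarrow> nat" where
  "c_num adj i = (if i = 0 then 0 else p_num adj i 1 (i - 1))"

definition a_num :: "('a::finite \<Rightarrow> 'a \<Rightarrow> bool) \<Rightarrow> nat \<Rightarrow> nat" where
  "a_num adj i = p_num adj i 1 i"

definition b_num :: "('a::finite \<Rightarrow> 'a \<Rightarrow> bool) \<Rightarrow> nat \<Rightarrow> nat" where
  "b_num adj i = (if i = graph_diameter adj then 0 else p_num adj i 1 (i + 1))"

definition k_num :: "('a::finite \<Rightarrow> 'a \<Rightarrow> bool) \<Rightarrow> nat \<Rightarrow> nat" where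
  "k_num adj i = p_num adj 0 i i"

definition graph_iso :: "('a \<Rightarrow> 'a \<Rightarrow> bool) \<Rightarrow> 'b set \<Rightarrow> ('b \<Rightarrow> 'b \<Rightarrow> bool) \<Rightarrow> bool" where
  "graph_iso adj W adj' \<longleftrightarrow>
     (\<exists>f. bij_betw f UNIV W \<and> (\<forall>x y. adj x y \<longleftrightarrow> adj' (f x) (f y)))"

definition is_hypercube :: "('a \<Rightarrow> 'a \<Rightarrow> bool) \<Rightarrow> bool" where
  "is_hypercube adj \<longleftrightarrow> (\<exists>n. graph_iso adj {w::bool list. length w = n}
     (\<lambda>v w. card {i. i < n \<and> v ! i \<noteq> w ! i} = 1))"

definition is_cycle_graph :: "('a \<Rightarrow> 'a \<Rightarrow> bool) \<Rightarrow> bool" where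
  "is_cycle_graph adj \<longleftrightarrow> (\<exists>n\<ge>3. graph_iso adj {..<n::nat}
     (\<lambda>i j. j = (i + 1) mod n \<or> i = (j + 1) mod n))"

section \<open>Primitive idempotents and the \<open>Q\<close>-polynomial property\<close>

text \<open>
  \<open>V = complex ^ 'a\<close>, and endomorphisms of \<open>V\<close> are square matrices with entries indexed
  by vertices.  HOL-Analysis has no complex vector space structure on matrices.
\<close>

definition mscale :: "complex \<Rightarrow> complex ^ 'n ^ 'm \<Rightarrow> complex ^ 'n ^ 'm" where
  "mscale c M = (\<chi> i j. c * M $ i $ j)"

global_interpretation mat: vector_space mscale
  by unfold_locales (simp_all add: mscale_def vec_eq_iff algebra_simps)

definition hadamard :: "complex ^ 'n ^ 'm \<Rightarrow> complex ^ 'n ^ 'm \<Rightarrow> complex ^ 'n ^ 'm" where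
  "hadamard M N = (\<chi> i j. M $ i $ j * N $ i $ j)"

definition dist_matrix :: "('a::finite \<Rightarrow> 'a \<Rightarrow> bool) \<Rightarrow> nat \<Rightarrow> complex ^ 'a ^ 'a" where
  "dist_matrix adj i = (\<chi> y x. if y \<in> sphere_at adj i x then 1 else 0)"

definition bose_mesner :: "('a::finite \<Rightarrow> 'a \<Rightarrow> bool) \<Rightarrow> (complex ^ 'a ^ 'a) set" where
  "bose_mesner adj = mat.span (dist_matrix adj ` {..graph_diameter adj})"

text \<open>\<open>E 0, \<dots>, E D\<close> is an ordering of the primitive idempotents that starts with the
  trivial one; values of \<open>E\<close> beyond \<open>D\<close> are irrelevant.\<close>

definition primitive_idempotents ::
  "('a::finite \<Rightarrow> 'a \<Rightarrow> bool) \<Rightarrow> (nat \<Rightarrow> complex ^ 'a ^ 'a) \<Rightarrow> bool" where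
  "primitive_idempotents adj E \<longleftrightarrow>
     inj_on E {..graph_diameter adj} \<and>
     mat.independent (E ` {..graph_diameter adj}) \<and>
     mat.span (E ` {..graph_diameter adj}) = bose_mesner adj \<and>
     (\<forall>i\<le>graph_diameter adj. \<forall>j\<le>graph_diameter adj. E i ** E j = (if i = j then E i else 0)) \<and>
     (\<Sum>i\<le>graph_diameter adj. E i) = mat 1 \<and>
     E 0 = mscale (1 / of_nat CARD('a)) (\<Sum>i\<le>graph_diameter adj. dist_matrix adj i)"

text \<open>\<open>Q h i j\<close> is the Krein parameter with upper index \<open>h\<close>.\<close>

definition krein_parameters ::
  "('a::finite \<Rightarrow> 'a \<Rightarrow> bool) \<Rightarrow> (nat \<Rightarrow> complex ^ 'a ^ 'a) \<Rightarrow>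
   (nat \<Rightarrow> nat \<Rightarrow> nat \<Rightarrow> complex) \<Rightarrow> bool" where
  "krein_parameters adj E Q \<longleftrightarrow>
     (\<forall>i\<le>graph_diameter adj. \<forall>j\<le>graph_diameter adj.
        hadamard (E i) (E j) =
        mscale (1 / of_nat CARD('a)) (\<Sum>h\<le>graph_diameter adj. mscale (Q h i j) (E h)))"

definition Q_polynomial_ordering ::
  "('a::finite \<Rightarrow> 'a \<Rightarrow> bool) \<Rightarrow> (nat \<Rightarrow> complex ^ 'a ^ 'a) \<Rightarrow> bool" where
  "Q_polynomial_ordering adj E \<longleftrightarrow> primitive_idempotents adj E \<and>
     (\<exists>Q. krein_parameters adj E Q \<and>
        (\<forall>h\<le>graph_diameter adj. \<forall>i\<le>graph_diameter adj. \<forall>j\<le>graph_diameter adj.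
           (h > i + j \<or> i > h + j \<or> j > h + i \<longrightarrow> Q h i j = 0) \<and>
           (h = i + j \<or> i = h + j \<or> j = h + i \<longrightarrow> Q h i j \<noteq> 0)))"

definition two_homogeneous_bipartite :: "('a::finite \<Rightarrow> 'a \<Rightarrow> bool) \<Rightarrow> bool" where
  "two_homogeneous_bipartite adj \<longleftrightarrow> distance_regular adj \<and>
     (\<forall>i\<le>graph_diameter adj. a_num adj i = 0) \<and>
     k_num adj (graph_diameter adj) = 1 \<and>
     (\<exists>E. Q_polynomial_ordering adj E)"

section \<open>The space \<open>\<Lambda>\<close> and the six maps\<close>

text \<open>The tensor cube of \<open>V\<close> is realised as the space with coordinates indexed by triples
  of vertices.\<close>

definition tensor3 ::
  "complex ^ 'a \<Rightarrow> complex ^ 'a \<Rightarrow> complex ^ 'a \<Rightarrow> complex ^ ('a \<times> 'a \<times> 'a)" where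
  "tensor3 u v w = (\<chi> p. case p of (x, y, z) \<Rightarrow> u $ x * v $ y * w $ z)"

definition basis_tensor :: "'a::finite \<Rightarrow> 'a \<Rightarrow> 'a \<Rightarrow> complex ^ ('a \<times> 'a \<times> 'a)" where
  "basis_tensor x y z = tensor3 (axis x 1) (axis y 1) (axis z 1)"

text \<open>The linear map with \<open>x \<otimes> y \<otimes> z \<mapsto> f x y z\<close> for all vertices \<open>x, y, z\<close>.\<close>

definition tensor_map ::
  "('a::finite \<Rightarrow> 'a \<Rightarrow> 'a \<Rightarrow> complex ^ ('a \<times> 'a \<times> 'a)) \<Rightarrow>
   complex ^ ('a \<times> 'a \<times> 'a) \<Rightarrow> complex ^ ('a \<times> 'a \<times> 'a)" where
  "tensor_map f v = (\<Sum>(x, y, z)\<in>UNIV. v $ (x, y, z) *s f x y z)"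

lemma basis_tensor_eq_axis: "basis_tensor x y z = axis (x, y, z) 1"
  by (auto simp: basis_tensor_def tensor3_def axis_def vec_eq_iff)

lemma tensor_map_basis_tensor: "tensor_map f (basis_tensor x y z) = f x y z"
proof -
  have "tensor_map f (basis_tensor x y z) =
      (\<Sum>p\<in>UNIV. if p = (x, y, z) then (case p of (x, y, z) \<Rightarrow> f x y z) else 0)"
    unfolding tensor_map_def basis_tensor_eq_axis
    by (intro sum.cong) (auto simp: axis_def vec_eq_iff split: if_splits)
  then show ?thesis by simp
qed

definition A1 :: "('a::finite \<Rightarrow> 'a \<Rightarrow> bool) \<Rightarrow>
    complex ^ ('a \<times> 'a \<times> 'a) \<Rightarrow> complex ^ ('a \<times> 'a \<times> 'a)" where
  "A1 adj = tensor_map (\<lambda>x y z. \<Sum>\<xi>\<in>sphere_at adj 1 x. basis_tensor \<xi> y z)"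

definition A2 :: "('a::finite \<Rightarrow> 'a \<Rightarrow> bool) \<Rightarrow>
    complex ^ ('a \<times> 'a \<times> 'a) \<Rightarrow> complex ^ ('a \<times> 'a \<times> 'a)" where
  "A2 adj = tensor_map (\<lambda>x y z. \<Sum>\<xi>\<in>sphere_at adj 1 y. basis_tensor x \<xi> z)"

definition A3 :: "('a::finite \<Rightarrow> 'a \<Rightarrow> bool) \<Rightarrow>
    complex ^ ('a \<times> 'a \<times> 'a) \<Rightarrow> complex ^ ('a \<times> 'a \<times> 'a)" where
  "A3 adj = tensor_map (\<lambda>x y z. \<Sum>\<xi>\<in>sphere_at adj 1 z. basis_tensor x y \<xi>)"

text \<open>In the dual maps, \<open>\<theta>s\<close> is the dual eigenvalue sequence.\<close>

definition A1s :: "('a::finite \<Rightarrow> 'a \<Rightarrow> bool) \<Rightarrow> (nat \<Rightarrow> complex) \<Rightarrow>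
    complex ^ ('a \<times> 'a \<times> 'a) \<Rightarrow> complex ^ ('a \<times> 'a \<times> 'a)" where
  "A1s adj \<theta>s = tensor_map (\<lambda>x y z. \<theta>s (gdist adj y z) *s basis_tensor x y z)"

definition A2s :: "('a::finite \<Rightarrow> 'a \<Rightarrow> bool) \<Rightarrow> (nat \<Rightarrow> complex) \<Rightarrow>
    complex ^ ('a \<times> 'a \<times> 'a) \<Rightarrow> complex ^ ('a \<times> 'a \<times> 'a)" where
  "A2s adj \<theta>s = tensor_map (\<lambda>x y z. \<theta>s (gdist adj z x) *s basis_tensor x y z)"

definition A3s :: "('a::finite \<Rightarrow> 'a \<Rightarrow> bool) \<Rightarrow> (nat \<Rightarrow> complex) \<Rightarrow>
    complex ^ ('a \<times> 'a \<times> 'a) \<Rightarrow> complex ^ ('a \<times> 'a \<times> 'a)" where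
  "A3s adj \<theta>s = tensor_map (\<lambda>x y z. \<theta>s (gdist adj x y) *s basis_tensor x y z)"

definition profiles :: "nat \<Rightarrow> (nat \<times> nat \<times> nat \<times> nat) set" where
  "profiles D = {(r, s, t, u). r + s + t + u = D}"

text \<open>For \<open>(r, s, t, u)\<close> in \<open>profiles D\<close> with \<open>D\<close> the diameter.\<close>

definition has_profile ::
  "('a::finite \<Rightarrow> 'a \<Rightarrow> bool) \<Rightarrow> nat \<times> nat \<times> nat \<times> nat \<Rightarrow> 'a \<Rightarrow> 'a \<Rightarrow> 'a \<Rightarrow> bool" where
  "has_profile adj = (\<lambda>(r, s, t, u) x y z.
     gdist adj x y = s + t \<and> gdist adj y z = t + u \<and> gdist adj z x = u + s)"

definition profile_vector ::
  "('a::finite \<Rightarrow> 'a \<Rightarrow> bool) \<Rightarrow> nat \<times> nat \<times> nat \<times> nat \<Rightarrow> complex ^ ('a \<times> 'a \<times> 'a)" where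
  "profile_vector adj p =
     (\<Sum>(x, y, z)\<in>{(x, y, z). has_profile adj p x y z}. basis_tensor x y z)"

definition Lambda_space :: "('a::finite \<Rightarrow> 'a \<Rightarrow> bool) \<Rightarrow> (complex ^ ('a \<times> 'a \<times> 'a)) set" where
  "Lambda_space adj = vec.span (profile_vector adj ` profiles (graph_diameter adj))"

section \<open>The algebra \<open>U'\<^sub>q(so\<^sub>6)\<close>\<close>

text \<open>
  The free complex algebra on \<open>'g\<close> is the monoid algebra of the free monoid on \<open>'g\<close>.
  The monoid operation is written additively because \<open>\<Rightarrow>\<^sub>0\<close> takes its convolution product
  from addition of exponents; it is not commutative.
\<close>

datatype 'g free_monoid = Word (letters: "'g list")

instantiation free_monoid :: (type) monoid_add
begin

definition zero_free_monoid :: "'a free_monoid" where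
  "zero_free_monoid = Word []"

definition plus_free_monoid :: "'a free_monoid \<Rightarrow> 'a free_monoid \<Rightarrow> 'a free_monoid" where
  "plus_free_monoid v w = Word (letters v @ letters w)"

instance
  by standard (simp_all add: zero_free_monoid_def plus_free_monoid_def)

end

type_synonym 'g free_algebra = "'g free_monoid \<Rightarrow>\<^sub>0 complex"

definition free_gen :: "'g \<Rightarrow> 'g free_algebra" where
  "free_gen g = Poly_Mapping.single (Word [g]) 1"

definition free_const :: "complex \<Rightarrow> 'g free_algebra" where
  "free_const c = Poly_Mapping.single 0 c"

definition free_ring :: "'g free_algebra ring" where
  "free_ring = \<lparr>carrier = UNIV, mult = (*), one = 1, zero = 0, add = (+)\<rparr>"

lemma ring_free_ring: "ring (free_ring :: 'g free_algebra ring)"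
proof (rule ringI)
  show "abelian_group (free_ring :: 'g free_algebra ring)"
    by (rule abelian_groupI)
      (auto simp: free_ring_def algebra_simps intro: exI[of _ "- x" for x])
  show "Group.monoid (free_ring :: 'g free_algebra ring)"
    by (rule monoidI) (auto simp: free_ring_def algebra_simps)
qed (auto simp: free_ring_def algebra_simps)

datatype so6_gen = G1 | G2 | G3 | G4 | G5

primrec gen_index :: "so6_gen \<Rightarrow> int" where
  "gen_index G1 = 1"
| "gen_index G2 = 2"
| "gen_index G3 = 3"
| "gen_index G4 = 4"
| "gen_index G5 = 5"

definition so6_relators :: "complex \<Rightarrow> so6_gen free_algebra set" where
  "so6_relators q =
     {free_gen i * free_gen i * free_gen j
        - free_const (q powi 2 + q powi (-2)) * (free_gen i * free_gen j * free_gen i)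
        + free_gen j * free_gen i * free_gen i + free_gen j
      |i j. \<bar>gen_index i - gen_index j\<bar> = 1}
     \<union> {free_gen i * free_gen j - free_gen j * free_gen i
      |i j. \<bar>gen_index i - gen_index j\<bar> \<ge> 2}"

definition so6_ideal :: "complex \<Rightarrow> so6_gen free_algebra set" where
  "so6_ideal q = Idl\<^bsub>free_ring\<^esub> (so6_relators q)"

definition Uso6 :: "complex \<Rightarrow> so6_gen free_algebra set ring" where
  "Uso6 q = free_ring Quot (so6_ideal q)"

lemma ring_Uso6: "ring (Uso6 q)"
  unfolding Uso6_def so6_ideal_def
  by (intro ideal.quotient_is_ring ring.genideal_ideal ring_free_ring)
    (simp add: free_ring_def)

definition Uso6_class :: "complex \<Rightarrow> so6_gen free_algebra \<Rightarrow> so6_gen free_algebra set" where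
  "Uso6_class q f = so6_ideal q +>\<^bsub>free_ring\<^esub> f"

definition Uso6_scale ::
  "complex \<Rightarrow> complex \<Rightarrow> so6_gen free_algebra set \<Rightarrow> so6_gen free_algebra set" where
  "Uso6_scale q c a = Uso6_class q (free_const c) \<otimes>\<^bsub>Uso6 q\<^esub> a"

definition Bgen :: "complex \<Rightarrow> so6_gen \<Rightarrow> so6_gen free_algebra set" where
  "Bgen q g = Uso6_class q (free_gen g)"

definition q_bracket ::
  "complex \<Rightarrow> so6_gen free_algebra set \<Rightarrow> so6_gen free_algebra set \<Rightarrow> so6_gen free_algebra set" where
  "q_bracket q R S =
     Uso6_scale q q (R \<otimes>\<^bsub>Uso6 q\<^esub> S) \<ominus>\<^bsub>Uso6 q\<^esub> Uso6_scale q (inverse q) (S \<otimes>\<^bsub>Uso6 q\<^esub> R)"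

definition B6 :: "complex \<Rightarrow> so6_gen free_algebra set" where
  "B6 q = \<ominus>\<^bsub>Uso6 q\<^esub> q_bracket q (Bgen q G1) (q_bracket q (Bgen q G2)
     (q_bracket q (Bgen q G3) (q_bracket q (Bgen q G4) (Bgen q G5))))"

text \<open>
  \<open>act\<close> makes the subspace \<open>L\<close> a left module over the unital complex algebra with
  underlying ring \<open>U\<close> and scalar multiplication \<open>scl\<close>.
\<close>

definition algebra_module ::
  "('u, 'm) ring_scheme \<Rightarrow> (complex \<Rightarrow> 'u \<Rightarrow> 'u) \<Rightarrow> (complex ^ 'n) set \<Rightarrow>
   ('u \<Rightarrow> complex ^ 'n \<Rightarrow> complex ^ 'n) \<Rightarrow> bool" where
  "algebra_module U scl L act \<longleftrightarrow> vec.subspace L \<and>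
     (\<forall>a\<in>carrier U. \<forall>v\<in>L. act a v \<in> L) \<and>
     (\<forall>a\<in>carrier U. \<forall>v\<in>L. \<forall>w\<in>L. act a (v + w) = act a v + act a w) \<and>
     (\<forall>a\<in>carrier U. \<forall>v\<in>L. \<forall>c. act a (c *s v) = c *s act a v) \<and>
     (\<forall>a\<in>carrier U. \<forall>b\<in>carrier U. \<forall>v\<in>L. act (a \<oplus>\<^bsub>U\<^esub> b) v = act a v + act b v) \<and>
     (\<forall>a\<in>carrier U. \<forall>v\<in>L. \<forall>c. act (scl c a) v = c *s act a v) \<and>
     (\<forall>a\<in>carrier U. \<forall>b\<in>carrier U. \<forall>v\<in>L. act (a \<otimes>\<^bsub>U\<^esub> b) v = act a (act b v)) \<and>
     (\<forall>v\<in>L. act \<one>\<^bsub>U\<^esub> v = v)"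

end

theory Submission
  imports Defs
begin

text \<open>
  Normalise the six maps of the theorem so that they become \<open>B\<^sub>1, \<dots>, B\<^sub>6\<close>, and let \<open>\<theta>\<close> be the common
  sequence of eigenvalues and dual eigenvalues.

  The defining relations hold on the whole tensor cube, not only on \<open>\<Lambda>\<close>.  Maps with distant
  indices commute: both are diagonal, or they move different vertices, or the vertex that one of them
  moves is not seen by the distance in the other.  A relation between neighbouring indices involves one
  moving vertex \<open>x\<close> and one fixed vertex \<open>y\<close>.  If the distance map is the one that occurs twice, the
  relation is an identity between \<open>\<theta> i\<close> and \<open>\<theta> (i + 1)\<close>, because in a bipartite graph a step changes
  every distance by one (\<open>diagonal_relation\<close>).  If the adjacency map occurs twice, the relation says
  that for vertices \<open>x\<close> and \<open>\<eta>\<close> at distance 2 the sum of \<open>\<theta> (d \<xi> y)\<close> over their common neighbours \<open>\<xi>\<close>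
  is a fixed multiple of \<open>\<theta> (d x y) + \<theta> (d \<eta> y)\<close> (\<open>adjacency_relation\<close>).

  That fact is an instance of the lemma \<open>balanced\<close>, on which everything rests.  Let \<open>C\<close> be the set of
  neighbours of \<open>x\<close> that are closer to \<open>y\<close>, and regard \<open>E 1\<close> as an orthogonal projection.  The
  projection of the sum of \<open>C\<close> is a linear combination of the projections of \<open>x\<close> and \<open>y\<close>.  Indeed,
  two distinct elements of \<open>C\<close> are at distance 2, so every inner product between these
  projections is known from the parameters, and one can check that the difference of the two sides
  has norm zero.

  The formula for \<open>B\<^sub>6\<close> does need \<open>\<Lambda>\<close>.  Evaluated at a third vertex \<open>z\<close>, the lemma \<open>balanced\<close>
  supplies the equation that the intersection numbers leave missing, and so determines how many
  neighbours of \<open>x\<close> change the profile \<open>(r, s, t, u)\<close> of \<open>(x, y, z)\<close> in each of the four possible ways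
  (\<open>card_nbrs_closer\<close>, \<open>card_nbrs_farther\<close>).  Hence every triple of vertices has a profile, \<open>\<Lambda>\<close> is the space
  of functions of the profile, and the adjacency maps become explicit difference operators on such
  functions.  A rational identity between their coefficients (\<open>rate_hexagon\<close>, \<open>hexagon\<close>) gives
  \<open>[B\<^sub>3, [B\<^sub>4, B\<^sub>5]] = - [[B\<^sub>6, B\<^sub>1], B\<^sub>2]\<close> on \<open>\<Lambda>\<close>.  With \<open>Y = [B\<^sub>6, B\<^sub>1]\<close>, the cubic relations already
  proved say that \<open>[B\<^sub>2, [Y, B\<^sub>2]] = Y\<close> and \<open>[B\<^sub>1, Y] = B\<^sub>6\<close>, and the formula for \<open>B\<^sub>6\<close> follows.
\<close>

section \<open>Laurent expressions in \<open>q\<close> and the hexagon identity\<close>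

type_synonym profile_function = "int \<Rightarrow> int \<Rightarrow> int \<Rightarrow> int \<Rightarrow> complex"

locale not_root_of_unity =
  fixes q :: complex
  assumes q_nonzero: "q \<noteq> 0" and q_power: "\<And>n. n > 0 \<Longrightarrow> q ^ n \<noteq> 1"
begin

definition qdiff :: "int \<Rightarrow> complex" where "qdiff e = q powi e - q powi (- e)"
definition qsum :: "int \<Rightarrow> complex" where "qsum e = q powi e + q powi (- e)"

lemma q_powi_eq_1_iff: "q powi e = 1 \<longleftrightarrow> e = 0"
proof
  assume 1: "q powi e = 1"
  show "e = 0"
  proof (rule ccontr)
    assume "e \<noteq> 0"
    have "q ^ nat \<bar>e\<bar> = 1"
      using 1 by (cases "e \<ge> 0") (auto simp: power_int_def power_inverse)
    with q_power[of "nat \<bar>e\<bar>"] \<open>e \<noteq> 0\<close> show False by simp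
  qed
qed simp

lemma qsum_nonzero [simp]: "qsum e \<noteq> 0"
proof
  assume "qsum e = 0"
  then have *: "q powi e = - (q powi (- e))"
    by (simp add: qsum_def add_eq_0_iff)
  have "q powi (4 * e) = (q powi e * q powi e)\<^sup>2"
    by (simp add: power2_eq_square power_int_add q_nonzero flip: power_int_add)
  also have "q powi e * q powi e = - (q powi e * q powi (- e))"
    using * by simp
  also have "\<dots> = -1"
    using q_nonzero by (simp add: power_int_minus)
  finally have "e = 0"
    by (simp add: q_powi_eq_1_iff)
  with \<open>qsum e = 0\<close> show False by (simp add: qsum_def)
qed

lemma qdiff_eq_0_iff: "qdiff e = 0 \<longleftrightarrow> e = 0"
proof
  assume "qdiff e = 0"
  then have "q powi e * q powi e = q powi (- e) * q powi e"
    by (simp add: qdiff_def)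
  then have "q powi e * q powi e = 1"
    using q_nonzero by (simp flip: power_int_add)
  then show "e = 0"
    using q_powi_eq_1_iff[of "2 * e"] q_nonzero by (simp flip: power_int_add)
qed (simp add: qdiff_def)

lemma qdiff_0 [simp]: "qdiff 0 = 0" by (simp add: qdiff_def)
lemma qdiff_minus: "qdiff (- e) = - qdiff e" by (simp add: qdiff_def)
lemma qsum_minus: "qsum (- e) = qsum e" by (simp add: qsum_def add.commute)

text \<open>
  Used from left to right, these equations bring a Laurent polynomial in \<open>q\<close> with symbolic exponents
  into a normal form, so that identities between such polynomials are proved by simplification.
\<close>

lemma q_powi_mult:
  "q powi a * q powi b = q powi (a + b)" "q powi a * (q powi b * z) = q powi (a + b) * z"
  by (simp_all add: q_nonzero power_int_add mult.assoc)

lemma qdiff_mult_qdiff: "qdiff a * qdiff b = qsum (a + b) - qsum (a - b)"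
  by (simp add: qdiff_def qsum_def q_powi_mult algebra_simps)
lemma qdiff_mult_qsum: "qdiff a * qsum b = qdiff (a + b) + qdiff (a - b)"
  by (simp add: qdiff_def qsum_def q_powi_mult algebra_simps)
lemma qsum_mult_qsum: "qsum a * qsum b = qsum (a + b) + qsum (a - b)"
  by (simp add: qdiff_def qsum_def q_powi_mult algebra_simps)

text \<open>
  The number of neighbours of a vertex of a triple that move one unit of the profile of the triple from
  the entry \<open>a\<close> to the entry \<open>b\<close> is \<open>h\<close> times this rational function, the other two entries being \<open>c\<close>
  and \<open>d\<close>.  It vanishes for \<open>a = 0\<close>, so that no entry becomes negative.
\<close>

definition rate :: "int \<Rightarrow> int \<Rightarrow> int \<Rightarrow> int \<Rightarrow> complex" where
  "rate a b c d = qdiff (2 * a) * qsum (c + d + a - b) / (qsum (a + c - b - d) * qsum (a + d - b - c))"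

text \<open>
  The two sums that occur in \<open>rate_hexagon\<close> are divisible by \<open>qsum (e - 2)\<close> and \<open>qsum (e + 2)\<close>
  respectively.  This removes the denominators that appear on its left side but not on its right side.
\<close>

lemma hexagon_factor_lower:
  "q powi (3 - e) * qsum (e + 2 * u) * qdiff (2 * t + 2) + q powi (e - 1) * qsum (e + 2 * t) * qdiff (2 * u + 2)
   = qsum (e - 2) * (q powi (e + 3 + 2*t + 2*u) - q powi (e - 1 + 2*t - 2*u)
        + q powi (3 + 2*t - 2*u - e) - q powi (- 1 - 2*t - 2*u - e))"
  by (simp add: qdiff_def qsum_def q_powi_mult algebra_simps)

lemma hexagon_factor_upper:
  "q powi (e + 3) * qsum (e + 2 * t + 2) * qdiff (2 * u) + q powi (- 1 - e) * qsum (e + 2 * u + 2) * qdiff (2 * t)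
   = qsum (e + 2) * (q powi (e + 3 + 2*t + 2*u) - q powi (e + 3 + 2*t - 2*u)
        + q powi (2*t - 2*u - e - 1) - q powi (- 1 - 2*t - 2*u - e))"
  by (simp add: qdiff_def qsum_def q_powi_mult algebra_simps)

text \<open>
  On each path, one vertex of the triple and then another one moves a unit of the profile, and the
  net effect of the two moves is to transfer a unit from \<open>r\<close> to \<open>s\<close>.  There are four such paths.
  Weighted with suitable powers of \<open>q\<close> their rates add up to a multiple of the rate at which the
  third vertex achieves the same transfer in a single move.
\<close>

lemma rate_hexagon:
  fixes r s t u :: int
  defines "e \<equiv> r + s - t - u"
  shows
   "q powi (e + 3) * rate u s r t * rate r (u - 1) (s + 1) t
  + q powi (- 1 - e) * rate t s r u * rate r (t - 1) (s + 1) u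
  - q powi (3 - e) * rate r t s u * rate (t + 1) s (r - 1) u
  - q powi (e - 1) * rate r u s t * rate (u + 1) s (r - 1) t
  = - ((q powi 3 - q powi (-1)) * q powi (2 * t - 2 * u) * rate r s t u)"
proof -
  let ?i = "r + u - s - t" and ?j = "r + t - s - u"
  let ?n = "qsum e * qsum ?i * qsum ?j" and ?m = "qdiff (2 * r) * qsum (r + t + u - s)"
  note sym = qsum_minus[of ?i] qsum_minus[of ?j] qsum_minus[of "e - 2"] qsum_minus[of "e + 2"] qsum_minus[of e]
  let ?A = "q powi (e + 3 + 2*t + 2*u) - q powi (e - 1 + 2*t - 2*u)
        + q powi (3 + 2*t - 2*u - e) - q powi (- 1 - 2*t - 2*u - e)"
  let ?B = "q powi (e + 3 + 2*t + 2*u) - q powi (e + 3 + 2*t - 2*u)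
        + q powi (2*t - 2*u - e - 1) - q powi (- 1 - 2*t - 2*u - e)"
  \<comment> \<open>All four products share the factors ?m and 1 / ?n.  What is left of the denominators is
    qsum (e - 2) in two of them and qsum (e + 2) in the other two.\<close>
  have 1: "rate r t s u * rate (t + 1) s (r - 1) u = ?m * (qsum (e + 2 * u) * qdiff (2 * t + 2)) / (?n * qsum (e - 2))"
    using sym by (simp add: rate_def e_def algebra_simps)
  have 2: "rate r u s t * rate (u + 1) s (r - 1) t = ?m * (qsum (e + 2 * t) * qdiff (2 * u + 2)) / (?n * qsum (e - 2))"
    using sym by (simp add: rate_def e_def algebra_simps)
  have 3: "rate u s r t * rate r (u - 1) (s + 1) t = ?m * (qsum (e + 2 * t + 2) * qdiff (2 * u)) / (?n * qsum (e + 2))"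
    using sym by (simp add: rate_def e_def algebra_simps)
  have 4: "rate t s r u * rate r (t - 1) (s + 1) u = ?m * (qsum (e + 2 * u + 2) * qdiff (2 * t)) / (?n * qsum (e + 2))"
    using sym by (simp add: rate_def e_def algebra_simps)
  have "q powi (3 - e) * (rate r t s u * rate (t + 1) s (r - 1) u)
      + q powi (e - 1) * (rate r u s t * rate (u + 1) s (r - 1) t) = ?m / ?n * ?A"
  proof -
    have "q powi (3 - e) * (rate r t s u * rate (t + 1) s (r - 1) u)
        + q powi (e - 1) * (rate r u s t * rate (u + 1) s (r - 1) t)
      = ?m * (q powi (3 - e) * qsum (e + 2 * u) * qdiff (2 * t + 2) + q powi (e - 1) * qsum (e + 2 * t) * qdiff (2 * u + 2))
         / (?n * qsum (e - 2))"
      unfolding 1 2 by (simp only: times_divide_eq_right add_divide_distrib distrib_left mult.assoc mult.left_commute)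
    then show ?thesis unfolding hexagon_factor_lower by (simp add: mult.assoc)
  qed
  moreover have "q powi (e + 3) * (rate u s r t * rate r (u - 1) (s + 1) t)
      + q powi (- 1 - e) * (rate t s r u * rate r (t - 1) (s + 1) u) = ?m / ?n * ?B"
  proof -
    have "q powi (e + 3) * (rate u s r t * rate r (u - 1) (s + 1) t)
      + q powi (- 1 - e) * (rate t s r u * rate r (t - 1) (s + 1) u)
      = ?m * (q powi (e + 3) * qsum (e + 2 * t + 2) * qdiff (2 * u) + q powi (- 1 - e) * qsum (e + 2 * u + 2) * qdiff (2 * t))
         / (?n * qsum (e + 2))"
      unfolding 3 4 by (simp only: times_divide_eq_right add_divide_distrib distrib_left mult.assoc mult.left_commute)
    then show ?thesis unfolding hexagon_factor_upper by (simp add: mult.assoc)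
  qed
  moreover have "?B - ?A = - ((q powi 3 - q powi (-1)) * q powi (2 * t - 2 * u) * qsum e)"
    unfolding qsum_def distrib_left left_diff_distrib q_powi_mult by (simp add: algebra_simps)
  moreover have "rate r s t u = ?m / ?n * qsum e"
    by (simp add: rate_def algebra_simps)
  moreover have "y - x = - (k * w * (c * z))"
    if "x = c * a" "y = c * b" "b - a = - (k * w * z)" for a b c k w x y z :: complex
  proof -
    have "y - x = c * (b - a)" using that(1,2) by (simp add: right_diff_distrib)
    then show ?thesis using that(3) by (simp add: ac_simps)
  qed
  ultimately show ?thesis
    by (simp only: mult.assoc diff_diff_eq)
qed

lemma rate_commute: "rate a b c e = rate a b e c" by (simp add: rate_def algebra_simps)

text \<open>
  Two moves out of the same entry, or into the same entry, can be exchanged, because the two products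
  of rates consist of the same factors.
\<close>

lemma rate_diverge: "rate a b e c * rate (a - 1) c e (b + 1) = rate a c e b * rate (a - 1) b e (c + 1)"
  using qsum_minus[of "a + e - b - c"] by (simp add: rate_def algebra_simps)

lemma rate_converge: "rate b a e c * rate c (a + 1) e (b - 1) = rate c a e b * rate b (a + 1) e (c - 1)"
  using qsum_minus[of "b + e - a - c"] by (simp add: rate_def algebra_simps)

text \<open>
  The adjacency maps on the first, second and third factor of the tensor cube, as operators on
  functions of the profile.  The vertex \<open>x\<close> enters the distances \<open>s + t\<close> and \<open>u + s\<close>; moving it
  exchanges a unit between \<open>r\<close> and \<open>s\<close> if both distances grow or both shrink, and between \<open>t\<close> and \<open>u\<close>
  otherwise.  For \<open>y\<close> the pairs are \<open>r, t\<close> and \<open>s, u\<close>, and for \<open>z\<close> they are \<open>r, u\<close> and \<open>s, t\<close>.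
\<close>

definition L1 :: "profile_function \<Rightarrow> profile_function" where
  "L1 F r s t u = rate r s t u * F (r - 1) (s + 1) t u + rate s r t u * F (r + 1) (s - 1) t u
     + (rate t u r s * F r s (t - 1) (u + 1) + rate u t r s * F r s (t + 1) (u - 1))"

definition L2 :: "profile_function \<Rightarrow> profile_function" where
  "L2 F r s t u = rate r t s u * F (r - 1) s (t + 1) u + rate t r s u * F (r + 1) s (t - 1) u
     + (rate s u r t * F r (s - 1) t (u + 1) + rate u s r t * F r (s + 1) t (u - 1))"

definition L3 :: "profile_function \<Rightarrow> profile_function" where
  "L3 F r s t u = rate r u s t * F (r - 1) s t (u + 1) + rate u r s t * F (r + 1) s t (u - 1)
     + (rate t s r u * F r (s + 1) (t - 1) u + rate s t r u * F r (s - 1) (t + 1) u)"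

abbreviation bracket_unit :: complex where "bracket_unit \<equiv> q powi 1 - q powi (- 3)"

text \<open>
  In a \<open>q\<close>-commutator of a distance map with an adjacency map, the coefficient of a step is such a
  combination of two consecutive eigenvalues.  It collapses to a single power of \<open>q\<close>, whose exponent
  depends on the direction of the step.
\<close>

lemma qdiff_bracket_up: "q powi 1 * qdiff e - q powi (- 1) * qdiff (e - 2) = bracket_unit * q powi e"
  unfolding qdiff_def right_diff_distrib left_diff_distrib q_powi_mult by (simp add: algebra_simps)
lemma qdiff_bracket_down: "q powi 1 * qdiff e - q powi (- 1) * qdiff (e + 2) = - (bracket_unit * q powi (- e))"
  unfolding qdiff_def right_diff_distrib left_diff_distrib q_powi_mult by (simp add: algebra_simps)

text \<open>
  Up to the factor \<open>bracket_unit\<close>, the \<open>q\<close>-commutator of the distance map for \<open>y, z\<close> with \<open>L3\<close>.  The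
  moves that increase the distance \<open>t + u\<close> come first, then those that decrease it.
\<close>

definition bracket_L3 :: "profile_function \<Rightarrow> profile_function" where
  "bracket_L3 F r s t u =
     q powi (r + s - t - u) * (rate r u s t * F (r - 1) s t (u + 1) + rate s t r u * F r (s - 1) (t + 1) u)
   - q powi (- (r + s - t - u)) * (rate u r s t * F (r + 1) s t (u - 1) + rate t s r u * F r (s + 1) (t - 1) u)"

lemma bracket_L3_eq:
  "q powi 1 * (qdiff (r + s - t - u) * L3 F r s t u)
    - q powi (- 1) * L3 (\<lambda>r s t u. qdiff (r + s - t - u) * F r s t u) r s t u = bracket_unit * bracket_L3 F r s t u"
proof -
  let ?e = "r + s - t - u"
  have "q powi 1 * (qdiff (r + s - t - u) * L3 F r s t u)
    - q powi (- 1) * L3 (\<lambda>r s t u. qdiff (r + s - t - u) * F r s t u) r s t u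
    = (q powi 1 * qdiff ?e - q powi (- 1) * qdiff (?e - 2)) * (rate r u s t * F (r - 1) s t (u + 1) + rate s t r u * F r (s - 1) (t + 1) u)
    + (q powi 1 * qdiff ?e - q powi (- 1) * qdiff (?e + 2)) * (rate u r s t * F (r + 1) s t (u - 1) + rate t s r u * F r (s + 1) (t - 1) u)"
    by (simp add: L3_def algebra_simps del: power_int_1_right power_int_minus1_right)
  then show ?thesis
    unfolding qdiff_bracket_up qdiff_bracket_down bracket_L3_def by (simp add: algebra_simps del: power_int_1_right power_int_minus1_right)
qed

text \<open>
  The common value, up to scalars, of the two nested \<open>q\<close>-commutators that are compared below; it
  involves only moves of the vertex \<open>x\<close>.
\<close>

definition hexagon_side :: "profile_function \<Rightarrow> profile_function" where
  "hexagon_side F r s t u =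
     q powi (2 * s - 2 * r) * rate u t r s * F r s (t + 1) (u - 1)
   + q powi (2 * r - 2 * s) * rate t u r s * F r s (t - 1) (u + 1)
   - q powi (2 * t - 2 * u) * rate r s t u * F (r - 1) (s + 1) t u
   - q powi (2 * u - 2 * t) * rate s r t u * F (r + 1) (s - 1) t u"

lemma bracket_bracket_L1:
  "q powi 1 * (q powi 1 * (qdiff (r + t - s - u) * L1 (\<lambda>r s t u. qdiff (r + u - s - t) * F r s t u) r s t u)
              - q powi (- 1) * L1 (\<lambda>r s t u. qdiff (r + t - s - u) * (qdiff (r + u - s - t) * F r s t u)) r s t u)
   - q powi (- 1) * (qdiff (r + u - s - t) *
              (q powi 1 * (qdiff (r + t - s - u) * L1 F r s t u)
              - q powi (- 1) * L1 (\<lambda>r s t u. qdiff (r + t - s - u) * F r s t u) r s t u))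
   = bracket_unit * (q powi 3 - q powi (-1)) * hexagon_side F r s t u"
proof -
  let ?i = "r + u - s - t" and ?j = "r + t - s - u"
  have flip: "q powi 1 * qdiff (e - 2) - q powi (- 1) * qdiff e = - ((q powi 3 - q powi (-1)) * q powi (- e))"
      "q powi 1 * qdiff (e + 2) - q powi (- 1) * qdiff e = (q powi 3 - q powi (-1)) * q powi e" for e
    unfolding qdiff_def right_diff_distrib left_diff_distrib q_powi_mult by (simp_all add: algebra_simps)
  have "q powi 1 * (q powi 1 * (qdiff ?j * L1 (\<lambda>r s t u. qdiff (r + u - s - t) * F r s t u) r s t u)
              - q powi (- 1) * L1 (\<lambda>r s t u. qdiff (r + t - s - u) * (qdiff (r + u - s - t) * F r s t u)) r s t u)
   - q powi (- 1) * (qdiff ?i * (q powi 1 * (qdiff ?j * L1 F r s t u)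
              - q powi (- 1) * L1 (\<lambda>r s t u. qdiff (r + t - s - u) * F r s t u) r s t u))
   = (q powi 1 * qdiff ?j - q powi (- 1) * qdiff (?j - 2)) * (q powi 1 * qdiff (?i - 2) - q powi (- 1) * qdiff ?i) * (rate r s t u * F (r - 1) (s + 1) t u)
   + (q powi 1 * qdiff ?j - q powi (- 1) * qdiff (?j + 2)) * (q powi 1 * qdiff (?i + 2) - q powi (- 1) * qdiff ?i) * (rate s r t u * F (r + 1) (s - 1) t u)
   + (q powi 1 * qdiff ?j - q powi (- 1) * qdiff (?j - 2)) * (q powi 1 * qdiff (?i + 2) - q powi (- 1) * qdiff ?i) * (rate t u r s * F r s (t - 1) (u + 1))
   + (q powi 1 * qdiff ?j - q powi (- 1) * qdiff (?j + 2)) * (q powi 1 * qdiff (?i - 2) - q powi (- 1) * qdiff ?i) * (rate u t r s * F r s (t + 1) (u - 1))"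
    unfolding L1_def by (simp add: algebra_simps del: power_int_1_right power_int_minus1_right)
  also have "\<dots> = bracket_unit * (q powi 3 - q powi (-1)) *
     (- (q powi (?j + - ?i) * (rate r s t u * F (r - 1) (s + 1) t u))
      - q powi (- ?j + ?i) * (rate s r t u * F (r + 1) (s - 1) t u)
      + q powi (?j + ?i) * (rate t u r s * F r s (t - 1) (u + 1))
      + q powi (- ?j + - ?i) * (rate u t r s * F r s (t + 1) (u - 1)))"
    unfolding qdiff_bracket_up qdiff_bracket_down flip q_powi_mult(1)[symmetric]
    by (simp add: algebra_simps del: power_int_1_right power_int_minus1_right)
  also have "\<dots> = bracket_unit * (q powi 3 - q powi (-1)) * hexagon_side F r s t u"
  proof -
    have e: "?j + - ?i = 2 * t - 2 * u" "- ?j + ?i = 2 * u - 2 * t" "?j + ?i = 2 * r - 2 * s"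
        "- ?j + - ?i = 2 * s - 2 * r" by simp_all
    show ?thesis unfolding e hexagon_side_def by (simp add: algebra_simps)
  qed
  finally show ?thesis .
qed

text \<open>
  Expanding the left side yields sixteen pairs of moves, one of \<open>y\<close> and one of \<open>z\<close>.  If both moves
  leave the same entry or enter the same entry, the distance of \<open>y\<close> and \<open>z\<close> changes by 2, and the two
  orders of the moves cancel.  The other eight pairs keep that distance, and in twos they have the
  effect of one move of \<open>x\<close>; these contributions are evaluated by \<open>rate_hexagon\<close>.
\<close>

lemma hexagon:
  "q powi 1 * L2 (bracket_L3 F) r s t u - q powi (- 1) * bracket_L3 (L2 F) r s t u = (q powi 3 - q powi (-1)) * hexagon_side F r s t u"
proof -
  let ?e = "r + s - t - u" and ?K = "q powi 3 - q powi (-1)"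
  have powers: "q powi 1 * q powi (?e + 2) = q powi (?e + 3)" "q powi 1 * q powi (- (?e - 2)) = q powi (3 - ?e)"
     "q powi (- 1) * q powi (- ?e) = q powi (- 1 - ?e)" "q powi (- 1) * q powi ?e = q powi (?e - 1)"
     "q powi 1 * q powi (?e - 2) = q powi (?e - 1)" "q powi 1 * q powi (- (?e + 2)) = q powi (- 1 - ?e)"
    unfolding q_powi_mult by (simp_all add: algebra_simps)
  have "q powi 1 * L2 (bracket_L3 F) r s t u - q powi (- 1) * bracket_L3 (L2 F) r s t u =
     ((q powi 1 * q powi (?e + 2)) * rate u s r t * rate r (u - 1) (s + 1) t + (q powi (- 1) * q powi (- ?e)) * rate t s r u * rate r (t - 1) (s + 1) u
       - (q powi 1 * q powi (- (?e - 2))) * rate r t s u * rate (t + 1) s (r - 1) u - (q powi (- 1) * q powi ?e) * rate r u s t * rate (u + 1) s (r - 1) t)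
       * F (r - 1) (s + 1) t u
   + ((q powi 1 * q powi (?e + 2)) * rate t r s u * rate s (t - 1) (r + 1) u + (q powi (- 1) * q powi (- ?e)) * rate u r s t * rate s (u - 1) (r + 1) t
       - (q powi 1 * q powi (- (?e - 2))) * rate s u r t * rate (u + 1) r (s - 1) t - (q powi (- 1) * q powi ?e) * rate s t r u * rate (t + 1) r (s - 1) u)
       * F (r + 1) (s - 1) t u
   + ((q powi 1 * q powi (?e + 2)) * rate u s r t * rate (s + 1) t r (u - 1) + (q powi (- 1) * q powi (- ?e)) * rate u r s t * rate (r + 1) t s (u - 1)
       - (q powi 1 * q powi (- (?e - 2))) * rate r t s u * rate u (r - 1) s (t + 1) - (q powi (- 1) * q powi ?e) * rate s t r u * rate u (s - 1) r (t + 1))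
       * F r s (t + 1) (u - 1)
   + ((q powi 1 * q powi (?e + 2)) * rate t r s u * rate (r + 1) u s (t - 1) + (q powi (- 1) * q powi (- ?e)) * rate t s r u * rate (s + 1) u r (t - 1)
       - (q powi 1 * q powi (- (?e - 2))) * rate s u r t * rate t (s - 1) r (u + 1) - (q powi (- 1) * q powi ?e) * rate r u s t * rate t (r - 1) s (u + 1))
       * F r s (t - 1) (u + 1)
   + ((q powi 1 * q powi (?e - 2)) * (rate r t s u * rate (r - 1) u s (t + 1)) - (q powi (- 1) * q powi ?e) * (rate r u s t * rate (r - 1) t s (u + 1))) * F (r - 2) s (t + 1) (u + 1)
   + ((q powi 1 * q powi (?e - 2)) * (rate r t s u * rate s (t + 1) (r - 1) u) - (q powi (- 1) * q powi ?e) * (rate s t r u * rate r (t + 1) (s - 1) u)) * F (r - 1) (s - 1) (t + 2) u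
   + ((q powi 1 * q powi (?e - 2)) * (rate s u r t * rate r (u + 1) (s - 1) t) - (q powi (- 1) * q powi ?e) * (rate r u s t * rate s (u + 1) (r - 1) t)) * F (r - 1) (s - 1) t (u + 2)
   + ((q powi 1 * q powi (?e - 2)) * (rate s u r t * rate (s - 1) t r (u + 1)) - (q powi (- 1) * q powi ?e) * (rate s t r u * rate (s - 1) u r (t + 1))) * F r (s - 2) (t + 1) (u + 1)
   + ((q powi (- 1) * q powi (- ?e)) * (rate u r s t * rate t (r + 1) s (u - 1)) - (q powi 1 * q powi (- (?e + 2))) * (rate t r s u * rate u (r + 1) s (t - 1))) * F (r + 2) s (t - 1) (u - 1)
   + ((q powi (- 1) * q powi (- ?e)) * (rate t s r u * rate (t - 1) r (s + 1) u) - (q powi 1 * q powi (- (?e + 2))) * (rate t r s u * rate (t - 1) s (r + 1) u)) * F (r + 1) (s + 1) (t - 2) u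
   + ((q powi (- 1) * q powi (- ?e)) * (rate u r s t * rate (u - 1) s (r + 1) t) - (q powi 1 * q powi (- (?e + 2))) * (rate u s r t * rate (u - 1) r (s + 1) t)) * F (r + 1) (s + 1) t (u - 2)
   + ((q powi (- 1) * q powi (- ?e)) * (rate t s r u * rate u (s + 1) r (t - 1)) - (q powi 1 * q powi (- (?e + 2))) * (rate u s r t * rate t (s + 1) r (u - 1))) * F r (s + 2) (t - 1) (u - 1)"
    \<comment> \<open>The first four summands collect the paths that keep the distance of the second and third vertex.\<close>
    unfolding L2_def bracket_L3_def
    by (simp add: algebra_simps del: power_int_1_right power_int_minus1_right)
  also have "\<dots> = ?K * hexagon_side F r s t u"
  proof -
    have 1: "q powi (?e + 3) * rate u s r t * rate r (u - 1) (s + 1) t + q powi (- 1 - ?e) * rate t s r u * rate r (t - 1) (s + 1) u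
       - q powi (3 - ?e) * rate r t s u * rate (t + 1) s (r - 1) u - q powi (?e - 1) * rate r u s t * rate (u + 1) s (r - 1) t
       = - (?K * q powi (2 * t - 2 * u) * rate r s t u)"
      by (rule rate_hexagon)
    have 2: "q powi (?e + 3) * rate t r s u * rate s (t - 1) (r + 1) u + q powi (- 1 - ?e) * rate u r s t * rate s (u - 1) (r + 1) t
       - q powi (3 - ?e) * rate s u r t * rate (u + 1) r (s - 1) t - q powi (?e - 1) * rate s t r u * rate (t + 1) r (s - 1) u
       = - (?K * q powi (2 * u - 2 * t) * rate s r t u)"
    proof -
      have e: "s + r - u - t = ?e" by simp
      show ?thesis using rate_hexagon[where r = s and s = r and t = u and u = t] unfolding e by (simp only: rate_commute[of s r])
    qed
    \<comment> \<open>For a unit that passes between t and u, the sign of ?e is reversed in the instance of rate_hexagon.\<close>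
    have neg: "c + e - a - b = x" if "a + b - c - e = - x" for a b c e x :: complex
    proof -
      have "c + e - a - b = - (a + b - c - e)" by simp
      then show ?thesis unfolding that by simp
    qed
    have 3: "q powi (?e + 3) * rate u s r t * rate (s + 1) t r (u - 1) + q powi (- 1 - ?e) * rate u r s t * rate (r + 1) t s (u - 1)
       - q powi (3 - ?e) * rate r t s u * rate u (r - 1) s (t + 1) - q powi (?e - 1) * rate s t r u * rate u (s - 1) r (t + 1)
       = ?K * q powi (2 * s - 2 * r) * rate u t r s"
    proof -
      have e: "u + t - s - r = - ?e" by simp
      have e': "- ?e + 3 = 3 - ?e" "- 1 - - ?e = ?e - 1" "3 - - ?e = ?e + 3" "- ?e - 1 = - 1 - ?e" by simp_all
      show ?thesis by (rule neg) (use rate_hexagon[where r = u and s = t and t = s and u = r, unfolded e e'] in \<open>simp only: rate_commute\<close>)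
    qed
    have 4: "q powi (?e + 3) * rate t r s u * rate (r + 1) u s (t - 1) + q powi (- 1 - ?e) * rate t s r u * rate (s + 1) u r (t - 1)
       - q powi (3 - ?e) * rate s u r t * rate t (s - 1) r (u + 1) - q powi (?e - 1) * rate r u s t * rate t (r - 1) s (u + 1)
       = ?K * q powi (2 * r - 2 * s) * rate t u r s"
    proof -
      have e: "t + u - r - s = - ?e" by simp
      have e': "- ?e + 3 = 3 - ?e" "- 1 - - ?e = ?e - 1" "3 - - ?e = ?e + 3" "- ?e - 1 = - 1 - ?e" by simp_all
      show ?thesis by (rule neg) (use rate_hexagon[where r = t and s = u and t = r and u = s, unfolded e e'] in \<open>simp only: rate_commute\<close>)
    qed
    have 5: "rate r t s u * rate (r - 1) u s (t + 1) = rate r u s t * rate (r - 1) t s (u + 1)"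
       "rate r t s u * rate s (t + 1) (r - 1) u = rate s t r u * rate r (t + 1) (s - 1) u"
       "rate s u r t * rate r (u + 1) (s - 1) t = rate r u s t * rate s (u + 1) (r - 1) t"
       "rate s u r t * rate (s - 1) t r (u + 1) = rate s t r u * rate (s - 1) u r (t + 1)"
       "rate u r s t * rate t (r + 1) s (u - 1) = rate t r s u * rate u (r + 1) s (t - 1)"
       "rate t s r u * rate (t - 1) r (s + 1) u = rate t r s u * rate (t - 1) s (r + 1) u"
       "rate u r s t * rate (u - 1) s (r + 1) t = rate u s r t * rate (u - 1) r (s + 1) t"
       "rate t s r u * rate u (s + 1) r (t - 1) = rate u s r t * rate t (s + 1) r (u - 1)"
      using rate_diverge[of r t s u] rate_converge[of r t u s] rate_converge[of s u t r] rate_diverge[of s u r t]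
        rate_converge[where b = u and a = r and e = s and c = t] rate_diverge[of t s u r] rate_diverge[of u r t s] rate_converge[where b = t and a = s and e = r and c = u]
      by (simp_all add: rate_commute)
    show ?thesis
      unfolding powers 1 2 3 4 5 hexagon_side_def by (simp add: algebra_simps del: power_int_1_right power_int_minus1_right)
  qed
  finally show ?thesis .
qed
end

section \<open>Path-length distance and intersection numbers\<close>

lemma relpowp_symp: "symp R \<Longrightarrow> (R ^^ n) x y \<Longrightarrow> (R ^^ n) y x"
proof (induction n arbitrary: x y)
  case (Suc n)
  then obtain z where "(R ^^ n) x z" "R z y" by auto
  with Suc have "(R ^^ n) z x" "R y z" by (auto dest: sympD)
  then show ?case by (blast intro: relpowp_Suc_I2)
qed simp

lemma gdist_le: "(adj ^^ n) x y \<Longrightarrow> gdist adj x y \<le> n"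
  unfolding gdist_def by (rule Least_le)

context
  fixes adj :: "'a::finite \<Rightarrow> 'a \<Rightarrow> bool"
  assumes conn: "connected_simple_graph adj"
begin

lemma gdist_walk: "(adj ^^ gdist adj x y) x y"
proof -
  have "\<exists>n. (adj ^^ n) x y"
    using conn by (intro rtranclp_imp_relpowp) (simp add: connected_simple_graph_def)
  then show ?thesis unfolding gdist_def by (rule LeastI_ex)
qed

lemma gdist_eq_0_iff: "gdist adj x y = 0 \<longleftrightarrow> x = y"
  using gdist_walk[of x y] gdist_le[of 0 adj x y] by auto

lemma gdist_commute: "gdist adj x y = gdist adj y x"
proof -
  have "gdist adj a b \<le> gdist adj b a" for a b
    using conn by (intro gdist_le relpowp_symp[OF _ gdist_walk]) (simp add: connected_simple_graph_def)
  then show ?thesis by (metis antisym)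
qed

lemma gdist_triangle: "gdist adj x z \<le> gdist adj x y + gdist adj y z"
  by (rule gdist_le) (simp only: relpowp_add, rule relcomppI, rule gdist_walk, rule gdist_walk)

lemma gdist_le_diameter: "gdist adj x y \<le> graph_diameter adj"
proof -
  have *: "{gdist adj x y |x y. True} = range (\<lambda>(x, y). gdist adj x y)" by auto
  show ?thesis unfolding graph_diameter_def * by (rule Max_ge) auto
qed

end

text \<open>
  The definition of \<open>p_num\<close> picks the unique constant value; it is unique because some pair of vertices
  has the distance in question, namely \<open>x\<close> and \<open>y\<close> themselves.
\<close>

lemma card_spheres_eq_p_num:
  assumes "distance_regular adj" and "i \<le> graph_diameter adj" "j \<le> graph_diameter adj"
  shows "card (sphere_at adj i x \<inter> sphere_at adj j y) = p_num adj (gdist adj x y) i j"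
proof -
  have conn: "connected_simple_graph adj" using assms(1) by (simp add: distance_regular_def)
  have *: "card (sphere_at adj i x' \<inter> sphere_at adj j y') = card (sphere_at adj i x \<inter> sphere_at adj j y)"
    if "gdist adj x' y' = gdist adj x y" for x' y'
  proof -
    have "gdist adj x y \<le> graph_diameter adj" by (rule gdist_le_diameter[OF conn])
    then show ?thesis
      using assms that unfolding distance_regular_def by blast
  qed
  show ?thesis
    unfolding p_num_def by (rule the_equality[symmetric]) (blast intro: *, blast)
qed

context
  fixes adj :: "'a::finite \<Rightarrow> 'a \<Rightarrow> bool"
  assumes dr: "distance_regular adj" and diam: "1 \<le> graph_diameter adj"
begin

lemma distance_regular_connected: "connected_simple_graph adj"
  using dr by (simp add: distance_regular_def)

lemma card_closer_eq_c_num: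
  "card {\<xi>. gdist adj x \<xi> = 1 \<and> int (gdist adj \<xi> y) = int (gdist adj x y) - 1} = c_num adj (gdist adj x y)"
proof (cases "gdist adj x y = 0")
  case False
  then have "{\<xi>. gdist adj x \<xi> = 1 \<and> int (gdist adj \<xi> y) = int (gdist adj x y) - 1}
      = sphere_at adj 1 x \<inter> sphere_at adj (gdist adj x y - 1) y"
    using gdist_commute[OF distance_regular_connected] by (auto simp: sphere_at_def)
  then show ?thesis
    using card_spheres_eq_p_num[OF dr diam, of "gdist adj x y - 1" x y] False
      gdist_le_diameter[OF distance_regular_connected, of x y] by (simp add: c_num_def)
qed (simp add: c_num_def)

lemma card_farther_eq_b_num:
  "card {\<xi>. gdist adj x \<xi> = 1 \<and> int (gdist adj \<xi> y) = int (gdist adj x y) + 1} = b_num adj (gdist adj x y)"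
proof (cases "gdist adj x y = graph_diameter adj")
  case True
  have "int (gdist adj \<xi> y) \<noteq> int (gdist adj x y) + 1" for \<xi>
    using gdist_le_diameter[OF distance_regular_connected, of \<xi> y] True by linarith
  then have "{\<xi>. gdist adj x \<xi> = 1 \<and> int (gdist adj \<xi> y) = int (gdist adj x y) + 1} = {}"
    by blast
  then show ?thesis using True by (simp only: b_num_def card.empty) simp
next
  case False
  have "{\<xi>. gdist adj x \<xi> = 1 \<and> int (gdist adj \<xi> y) = int (gdist adj x y) + 1}
      = sphere_at adj 1 x \<inter> sphere_at adj (gdist adj x y + 1) y"
    using gdist_commute[OF distance_regular_connected] by (auto simp: sphere_at_def)
  then show ?thesis
    using card_spheres_eq_p_num[OF dr diam, of "gdist adj x y + 1" x y] False
      gdist_le_diameter[OF distance_regular_connected, of x y] by (simp add: b_num_def)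
qed

lemma bipartite_gdist_neq:
  assumes "\<forall>i\<le>graph_diameter adj. a_num adj i = 0" and "gdist adj x \<xi> = 1"
  shows "gdist adj \<xi> y \<noteq> gdist adj x y"
proof
  assume eq: "gdist adj \<xi> y = gdist adj x y"
  have le: "gdist adj x y \<le> graph_diameter adj"
    by (rule gdist_le_diameter[OF distance_regular_connected])
  have "card (sphere_at adj 1 x \<inter> sphere_at adj (gdist adj x y) y) = 0"
    using card_spheres_eq_p_num[OF dr diam le, of x y] assms(1) le by (simp add: a_num_def)
  moreover have "\<xi> \<in> sphere_at adj 1 x \<inter> sphere_at adj (gdist adj x y) y"
    using eq assms(2) gdist_commute[OF distance_regular_connected, of y \<xi>] by (simp add: sphere_at_def)
  ultimately show False by auto
qed

end

section \<open>Reality and idempotence of the dual eigenvalue kernel\<close>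

text \<open>
  If \<open>K\<close> is \<open>n\<close> times a real symmetric idempotent matrix, then the squared norm of \<open>K v\<close> is \<open>n\<close> times the
  hermitian form of \<open>K\<close> at \<open>v\<close>.  The form only involves the values of \<open>K v\<close> on the support of \<open>v\<close>, so
  if they vanish, then \<open>K v\<close> vanishes everywhere.
\<close>

lemma real_idempotent_kernel_vanishing:
  fixes K :: "'a::finite \<Rightarrow> 'a \<Rightarrow> complex"
  assumes idem: "\<And>x y. (\<Sum>z\<in>UNIV. K x z * K z y) = n * K x y" and "n \<noteq> 0"
    and sym: "\<And>x y. K x y = K y x" and real: "\<And>x y. cnj (K x y) = K x y"
    and supp: "\<And>p. v p \<noteq> 0 \<Longrightarrow> (\<Sum>w\<in>UNIV. v w * K w p) = 0"
  shows "(\<Sum>w\<in>UNIV. v w * K w z) = 0"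
proof -
  define g where "g z = (\<Sum>w\<in>UNIV. v w * K w z)" for z
  have g: "(\<Sum>z\<in>UNIV. K p z * g z) = n * g p" for p
  proof -
    have "(\<Sum>z\<in>UNIV. K p z * g z) = (\<Sum>z\<in>UNIV. \<Sum>w\<in>UNIV. v w * (K w z * K z p))"
      unfolding g_def sum_distrib_left by (intro sum.cong refl) (simp add: sym[of p] mult.commute mult.left_commute)
    also have "\<dots> = (\<Sum>w\<in>UNIV. v w * (\<Sum>z\<in>UNIV. K w z * K z p))"
      by (subst sum.swap) (simp add: sum_distrib_left)
    also have "\<dots> = n * g p"
      unfolding idem g_def sum_distrib_left by (intro sum.cong refl) simp
    finally show ?thesis .
  qed
  \<comment> \<open>Moving K to the other factor and using g = K v turns the squared norm of g into a sum of the
    terms v w * cnj (n * g w), and each of them is zero by assumption.\<close>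
  have "(\<Sum>z\<in>UNIV. g z * cnj (g z)) = (\<Sum>z\<in>UNIV. \<Sum>w\<in>UNIV. v w * (K w z * cnj (g z)))"
    unfolding g_def[of z for z] sum_distrib_right by (simp add: mult.assoc)
  also have "\<dots> = (\<Sum>w\<in>UNIV. v w * (\<Sum>z\<in>UNIV. K w z * cnj (g z)))"
    by (subst sum.swap) (simp add: sum_distrib_left)
  also have "\<dots> = (\<Sum>w\<in>UNIV. v w * cnj (n * g w))"
  proof (intro sum.cong refl)
    fix w
    have "(\<Sum>z\<in>UNIV. K w z * cnj (g z)) = cnj (\<Sum>z\<in>UNIV. K w z * g z)"
      by (simp add: real)
    then show "v w * (\<Sum>z\<in>UNIV. K w z * cnj (g z)) = v w * cnj (n * g w)"
      by (simp only: g)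
  qed
  also have "\<dots> = 0"
    using supp by (intro sum.neutral ballI) (metis complex_cnj_zero g_def mult_zero_left mult_zero_right)
  finally have "(\<Sum>z\<in>UNIV. g z * cnj (g z)) = 0" .
  then have "complex_of_real (\<Sum>z\<in>UNIV. (cmod (g z))\<^sup>2) = 0"
    by (simp only: of_real_sum complex_norm_square)
  then have "(\<Sum>z\<in>UNIV. (cmod (g z))\<^sup>2) = 0"
    by (simp only: of_real_eq_0_iff)
  then show ?thesis
    by (subst (asm) sum_nonneg_eq_0_iff) (auto simp: g_def)
qed

lemma dist_matrix_nth: "dist_matrix adj i $ y $ x = (if gdist adj x y = i then 1 else 0)"
  by (simp add: dist_matrix_def sphere_at_def)

text \<open>
  A column of \<open>E\<close> that is not zero is an eigenvector of the real symmetric matrix \<open>dist_matrix adj i\<close>.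
\<close>

lemma eigenvalue_real:
  assumes conn: "connected_simple_graph adj"
    and eigen: "dist_matrix adj i ** E = mscale \<theta> E" and "E \<noteq> 0"
  shows "cnj \<theta> = \<theta>"
proof -
  let ?A = "dist_matrix adj i"
  obtain j k where jk: "E $ j $ k \<noteq> 0"
    using \<open>E \<noteq> 0\<close> by (auto simp: vec_eq_iff)
  define f where "f x = E $ x $ k" for x
  have f: "(\<Sum>y\<in>UNIV. ?A $ x $ y * f y) = \<theta> * f x" for x
  proof -
    have "(?A ** E) $ x $ k = mscale \<theta> E $ x $ k" by (simp only: eigen)
    then show ?thesis by (simp add: matrix_matrix_mult_def mscale_def f_def)
  qed
  let ?S = "\<Sum>x\<in>UNIV. cnj (f x) * f x"
  have S: "?S \<noteq> 0"
  proof
    assume "?S = 0"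
    then have "complex_of_real (\<Sum>x\<in>UNIV. (cmod (f x))\<^sup>2) = 0"
      unfolding of_real_sum complex_norm_square by (simp add: mult.commute)
    then have "(\<Sum>x\<in>UNIV. (cmod (f x))\<^sup>2) = 0"
      by (simp only: of_real_eq_0_iff)
    then have "(cmod (f j))\<^sup>2 = 0" by (subst (asm) sum_nonneg_eq_0_iff) auto
    then show False using jk by (simp add: f_def)
  qed
  have sym: "?A $ x $ y = ?A $ y $ x" for x y by (simp add: dist_matrix_nth gdist_commute[OF conn])
  have real: "cnj (?A $ x $ y) = ?A $ x $ y" for x y by (simp add: dist_matrix_nth)
  have "\<theta> * ?S = (\<Sum>x\<in>UNIV. cnj (f x) * (\<Sum>y\<in>UNIV. ?A $ x $ y * f y))"
    unfolding f by (simp add: sum_distrib_left mult.left_commute)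
  also have "\<dots> = (\<Sum>x\<in>UNIV. \<Sum>y\<in>UNIV. cnj (f x) * (?A $ x $ y * f y))"
    by (simp add: sum_distrib_left)
  also have "\<dots> = (\<Sum>y\<in>UNIV. \<Sum>x\<in>UNIV. cnj (f x) * (?A $ x $ y * f y))"
    by (rule sum.swap)
  also have "\<dots> = (\<Sum>y\<in>UNIV. f y * cnj (\<Sum>x\<in>UNIV. ?A $ y $ x * f x))"
    by (simp add: sum_distrib_left real sym mult.commute mult.left_commute)
  also have "\<dots> = cnj \<theta> * ?S"
    unfolding f by (simp add: sum_distrib_left mult.commute mult.left_commute)
  finally show ?thesis using S by simp
qed

text \<open>
  The idempotence of \<open>E\<close> in terms of its entries \<open>\<theta>s (gdist adj x y) / CARD('a)\<close>.
\<close>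

lemma dual_eigenvalue_convolution:
  assumes conn: "connected_simple_graph adj"
    and E: "E = mscale (1 / of_nat CARD('a)) (\<Sum>i\<le>graph_diameter adj. mscale (\<theta>s i) (dist_matrix adj i))"
    and idem: "E ** E = (E :: complex ^ 'a::finite ^ 'a)"
  shows "(\<Sum>z\<in>UNIV. \<theta>s (gdist adj x z) * \<theta>s (gdist adj z y)) = of_nat CARD('a) * \<theta>s (gdist adj x y)"
proof -
  let ?n = "of_nat CARD('a) :: complex"
  have nth: "E $ x $ y = \<theta>s (gdist adj x y) / ?n" for x y
  proof -
    have "E $ x $ y = (\<Sum>i\<le>graph_diameter adj. \<theta>s i * (if gdist adj x y = i then 1 else 0)) / ?n"
      unfolding E by (simp add: mscale_def dist_matrix_nth gdist_commute[OF conn, of y x])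
    also have "(\<Sum>i\<le>graph_diameter adj. \<theta>s i * (if gdist adj x y = i then 1 else 0))
        = (\<Sum>i\<le>graph_diameter adj. if i = gdist adj x y then \<theta>s i else 0)"
      by (intro sum.cong) auto
    also have "\<dots> = \<theta>s (gdist adj x y)" using gdist_le_diameter[OF conn, of x y] by simp
    finally show ?thesis .
  qed
  have "(E ** E) $ x $ y = E $ x $ y" by (simp only: idem)
  then have "(\<Sum>z\<in>UNIV. \<theta>s (gdist adj x z) / ?n * (\<theta>s (gdist adj z y) / ?n)) = \<theta>s (gdist adj x y) / ?n"
    by (simp add: matrix_matrix_mult_def nth)
  then have "(\<Sum>z\<in>UNIV. \<theta>s (gdist adj x z) * \<theta>s (gdist adj z y)) / (?n * ?n) = \<theta>s (gdist adj x y) / ?n"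
    by (simp add: sum_divide_distrib)
  then show ?thesis by (simp add: field_simps)
qed

section \<open>Counting neighbours in a 2-homogeneous bipartite graph\<close>

text \<open>
  The consequences of the hypotheses of the theorem that the argument uses.  Here \<open>h\<close> stands for the
  product of \<open>H\<close> with the imaginary unit, and distances are integers, so that \<open>\<theta>\<close> is defined at
  \<open>-1\<close> and \<open>D + 1\<close> too.
\<close>

locale two_homogeneous = not_root_of_unity +
  fixes adj :: "'a::finite \<Rightarrow> 'a \<Rightarrow> bool" and D :: nat and h :: complex
    and d :: "'a \<Rightarrow> 'a \<Rightarrow> int" and \<theta> :: "int \<Rightarrow> complex"
  defines "d \<equiv> \<lambda>x y. int (gdist adj x y)" and "\<theta> \<equiv> \<lambda>i. h * qdiff (int D - 2 * i)"
  assumes conn: "connected_simple_graph adj"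
    and D_diam: "D = graph_diameter adj"
    and bip: "d x \<xi> = 1 \<Longrightarrow> d \<xi> y \<noteq> d x y"
    and h_qdiff: "h * qdiff 2 = qsum (int D - 2)"
    and card_closer: "of_nat (card {\<xi>. d x \<xi> = 1 \<and> d \<xi> y = d x y - 1})
          = h * qdiff (2 * d x y) / qsum (int D - 2 * d x y)"
    and card_farther: "of_nat (card {\<xi>. d x \<xi> = 1 \<and> d \<xi> y = d x y + 1})
          = h * qdiff (2 * (int D - d x y)) / qsum (int D - 2 * d x y)"
    and \<theta>_idem: "(\<Sum>z\<in>UNIV. \<theta> (d x z) * \<theta> (d z y)) = of_nat CARD('a) * \<theta> (d x y)"
    and \<theta>_real: "cnj (\<theta> (d x y)) = \<theta> (d x y)"
begin

lemma h_nonzero: "h \<noteq> 0"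
  using h_qdiff qsum_nonzero[of "int D - 2"] by (metis mult_zero_left)

lemma d_eq_0_iff [simp]: "d x y = 0 \<longleftrightarrow> x = y" by (simp add: d_def gdist_eq_0_iff[OF conn])
lemma d_self [simp]: "d x x = 0" by simp
lemma d_commute: "d x y = d y x" by (simp add: d_def gdist_commute[OF conn])
lemma d_triangle: "d x z \<le> d x y + d y z"
  unfolding d_def using gdist_triangle[OF conn, of x z y] by linarith
lemma d_nonneg [simp]: "d x y \<ge> 0" by (simp add: d_def)

lemma neighbour_cases:
  assumes "d x \<xi> = 1"
  shows "d \<xi> y = d x y - 1 \<or> d \<xi> y = d x y + 1"
  using assms bip[OF assms, of y] d_triangle[of x y \<xi>] d_triangle[of \<xi> y x] d_commute[of \<xi> x]
  by linarith

lemma dist_between_neighbours: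
  assumes "d x w = 1" "d x w' = 1" "w \<noteq> w'"
  shows "d w w' = 2"
  using assms d_triangle[of w w' x] d_commute[of w x] d_nonneg[of w w'] bip[of w w' x] d_commute[of w' x]
    d_eq_0_iff[of w w'] by linarith

text \<open>
  Let \<open>C\<close> be the set over which the sum extends, let \<open>\<alpha>\<close> and \<open>\<beta>\<close> be the two coefficients on the right
  side, and let \<open>v\<close> be the formal combination \<open>C - \<alpha> x - \<beta> y\<close>.  It is to be shown that the kernel
  \<open>\<theta> (d p z)\<close> maps \<open>v\<close> to zero, and by \<open>real_idempotent_kernel_vanishing\<close> it suffices to check this at
  \<open>x\<close>, at \<open>y\<close> and at the elements of \<open>C\<close>.  At these vertices all distances are known, since distinct
  elements of \<open>C\<close> are at distance 2, and what remains is an identity in \<open>q\<close>.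
\<close>

lemma balanced:
  fixes x y z :: 'a
  assumes "x \<noteq> y"
  shows "(\<Sum>w\<in>{\<xi>. d x \<xi> = 1 \<and> d \<xi> y = d x y - 1}. \<theta> (d w z)) =
    h * qdiff (2 * d x y - 2) / qsum (int D - 2 * d x y) * \<theta> (d x z)
    + qsum (int D - 2) / qsum (int D - 2 * d x y) * \<theta> (d y z)"
proof -
  define C where "C = {\<xi>. d x \<xi> = 1 \<and> d \<xi> y = d x y - 1}"
  define i where "i = d x y"
  define \<alpha> where "\<alpha> = h * qdiff (2 * i - 2) / qsum (int D - 2 * i)"
  define \<beta> where "\<beta> = qsum (int D - 2) / qsum (int D - 2 * i)"
  define v :: "'a \<Rightarrow> complex" where
    "v p = (if p \<in> C then 1 else 0) - (if p = x then \<alpha> else 0) - (if p = y then \<beta> else 0)" for p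
  have g: "(\<Sum>p\<in>UNIV. v p * \<theta> (d p z)) = (\<Sum>w\<in>C. \<theta> (d w z)) - \<alpha> * \<theta> (d x z) - \<beta> * \<theta> (d y z)" for z
  proof -
    have "v p * \<theta> (d p z) = (if p \<in> C then \<theta> (d p z) else 0) - (if p = x then \<alpha> * \<theta> (d p z) else 0)
      - (if p = y then \<beta> * \<theta> (d p z) else 0)" for p
      by (auto simp: v_def algebra_simps)
    then show ?thesis by (simp add: sum_subtractf sum.If_cases)
  qed
  have card: "of_nat (card C) = h * qdiff (2 * i) / qsum (int D - 2 * i)"
    using card_closer[of x y] by (simp add: C_def i_def)
  have \<beta>: "\<beta> = h * qdiff 2 / qsum (int D - 2 * i)" by (simp add: \<beta>_def h_qdiff)
  have gx: "(\<Sum>w\<in>C. \<theta> (d w x)) - \<alpha> * \<theta> (d x x) - \<beta> * \<theta> (d y x) = 0"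
  proof -
    have "(\<Sum>w\<in>C. \<theta> (d w x)) = (\<Sum>w\<in>C. \<theta> 1)"
      by (intro sum.cong) (auto simp: C_def d_commute)
    moreover have "h * qdiff (2 * i) * \<theta> 1 - h * qdiff (2 * i - 2) * \<theta> 0 - h * qdiff 2 * \<theta> i = 0"
    proof -
      have "qdiff (2 * i) * qdiff (int D - 2) - qdiff (2 * i - 2) * qdiff (int D) - qdiff 2 * qdiff (int D - 2 * i) = 0"
        unfolding qdiff_mult_qdiff using qsum_minus[of "2 * i - (int D + 2)"] by (simp add: algebra_simps)
      then have "h * h * (qdiff (2 * i) * qdiff (int D - 2) - qdiff (2 * i - 2) * qdiff (int D) - qdiff 2 * qdiff (int D - 2 * i)) = 0"
        by simp
      then show ?thesis by (simp add: \<theta>_def algebra_simps)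
    qed
    ultimately show ?thesis
      by (simp add: card \<alpha>_def \<beta> d_commute[of y x] i_def flip: diff_divide_distrib)
  qed
  have gy: "(\<Sum>w\<in>C. \<theta> (d w y)) - \<alpha> * \<theta> (d x y) - \<beta> * \<theta> (d y y) = 0"
  proof -
    have "(\<Sum>w\<in>C. \<theta> (d w y)) = (\<Sum>w\<in>C. \<theta> (i - 1))"
      by (intro sum.cong) (auto simp: C_def i_def)
    moreover have "h * qdiff (2 * i) * \<theta> (i - 1) - h * qdiff (2 * i - 2) * \<theta> i - h * qdiff 2 * \<theta> 0 = 0"
    proof -
      have "qdiff (2 * i) * qdiff (int D - 2 * (i - 1)) - qdiff (2 * i - 2) * qdiff (int D - 2 * i) - qdiff 2 * qdiff (int D) = 0"
      proof -
        have "qsum (2 - int D) = qsum (int D - 2)" using qsum_minus[of "int D - 2"] by simp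
        then show ?thesis unfolding qdiff_mult_qdiff by (simp add: algebra_simps)
      qed
      then have "h * h * (qdiff (2 * i) * qdiff (int D - 2 * (i - 1)) - qdiff (2 * i - 2) * qdiff (int D - 2 * i) - qdiff 2 * qdiff (int D)) = 0"
        by simp
      then show ?thesis by (simp add: \<theta>_def algebra_simps)
    qed
    ultimately show ?thesis
      by (simp add: card \<alpha>_def \<beta> i_def flip: diff_divide_distrib)
  qed
  have gw: "(\<Sum>w\<in>C. \<theta> (d w w')) - \<alpha> * \<theta> (d x w') - \<beta> * \<theta> (d y w') = 0" if w': "w' \<in> C" for w'
  proof -
    have "(\<Sum>w\<in>C. \<theta> (d w w')) = \<theta> 0 + (\<Sum>w\<in>C - {w'}. \<theta> (d w w'))"
      using sum.remove[OF _ w', of "\<lambda>w. \<theta> (d w w')"] by simp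
    also have "(\<Sum>w\<in>C - {w'}. \<theta> (d w w')) = (\<Sum>w\<in>C - {w'}. \<theta> 2)"
    proof (intro sum.cong refl)
      fix w assume "w \<in> C - {w'}"
      then have "d w w' = 2"
        using w' by (intro dist_between_neighbours[of x]) (auto simp: C_def)
      then show "\<theta> (d w w') = \<theta> 2" by simp
    qed
    also have "\<dots> = (of_nat (card C) - 1) * \<theta> 2"
    proof -
      have "card C > 0" using w' by (auto simp: card_gt_0_iff)
      then show ?thesis using w' by (simp add: of_nat_diff)
    qed
    finally have 1: "(\<Sum>w\<in>C. \<theta> (d w w')) = \<theta> 0 - \<theta> 2 + of_nat (card C) * \<theta> 2"
      by (simp add: algebra_simps)
    have 2: "\<theta> 0 - \<theta> 2 = h * qdiff 2 * (h * qdiff 2)"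
    proof -
      have "qdiff (int D) - qdiff (int D - 4) = qdiff 2 * qsum (int D - 2)"
        unfolding qdiff_mult_qsum using qdiff_minus[of "int D - 4"] by (simp add: algebra_simps)
      then have "\<theta> 0 - \<theta> 2 = h * (qdiff 2 * qsum (int D - 2))"
        by (simp add: \<theta>_def flip: right_diff_distrib)
      then show ?thesis by (simp add: h_qdiff)
    qed
    have "h * qdiff 2 * (h * qdiff 2) * qsum (int D - 2 * i) + h * qdiff (2 * i) * \<theta> 2 - h * qdiff (2 * i - 2) * \<theta> 1 - h * qdiff 2 * \<theta> (i - 1) = 0"
    proof -
      have "qdiff 2 * (qdiff 2 * qsum (int D - 2 * i)) + qdiff (2 * i) * qdiff (int D - 4) - qdiff (2 * i - 2) * qdiff (int D - 2) - qdiff 2 * qdiff (int D - 2 * (i - 1)) = 0"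
        unfolding qdiff_mult_qdiff qdiff_mult_qsum distrib_left
        using qsum_minus[of "2 * i - int D"] qsum_minus[of "2 * i + 4 - int D"] qsum_minus[of "2 * i + 2 - int D"] by (simp add: algebra_simps)
      then have "h * h * (qdiff 2 * (qdiff 2 * qsum (int D - 2 * i)) + qdiff (2 * i) * qdiff (int D - 4) - qdiff (2 * i - 2) * qdiff (int D - 2) - qdiff 2 * qdiff (int D - 2 * (i - 1))) = 0"
        by simp
      then show ?thesis by (simp add: \<theta>_def algebra_simps)
    qed
    then have 3: "(h * qdiff 2 * (h * qdiff 2) * qsum (int D - 2 * i) + h * qdiff (2 * i) * \<theta> 2 - h * qdiff (2 * i - 2) * \<theta> 1 - h * qdiff 2 * \<theta> (i - 1)) / qsum (int D - 2 * i) = 0"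
      by simp
    have "d x w' = 1" "d y w' = i - 1" using w' d_commute[of y w'] by (auto simp: C_def i_def)
    with 3 show ?thesis
      unfolding 1 2 by (simp add: card \<alpha>_def \<beta> add_divide_distrib diff_divide_distrib)
  qed
  have "(\<Sum>p\<in>UNIV. v p * \<theta> (d p z)) = 0"
  proof (rule real_idempotent_kernel_vanishing[where n = "of_nat CARD('a)"])
    fix p assume "v p \<noteq> 0"
    then have "p = x \<or> p = y \<or> p \<in> C" by (auto simp: v_def split: if_splits)
    then show "(\<Sum>w\<in>UNIV. v w * \<theta> (d w p)) = 0"
      unfolding g using gx gy gw by blast
  next
    show "\<theta> (d a b) = \<theta> (d b a)" for a b by (simp only: d_commute)
  qed (simp_all add: \<theta>_idem \<theta>_real)
  then show ?thesis
    unfolding g by (simp add: C_def \<alpha>_def \<beta>_def i_def diff_eq_eq add.commute)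
qed

definition profile :: "'a \<Rightarrow> 'a \<Rightarrow> 'a \<Rightarrow> int \<Rightarrow> int \<Rightarrow> int \<Rightarrow> int \<Rightarrow> bool" where
  "profile x y z r s t u \<longleftrightarrow>
     d x y = s + t \<and> d y z = t + u \<and> d z x = u + s \<and> r + s + t + u = int D"

lemma profile_swap12: "profile x y z r s t u \<longleftrightarrow> profile y x z r t s u" 
  using d_commute[of x y] d_commute[of y z] d_commute[of x z] by (auto simp: profile_def)
lemma profile_swap13: "profile x y z r s t u \<longleftrightarrow> profile z y x r u t s" 
  using d_commute[of x y] d_commute[of y z] d_commute[of x z] by (auto simp: profile_def)
lemma profile_swap23: "profile x y z r s t u \<longleftrightarrow> profile x z y r s u t" 
  using d_commute[of x y] d_commute[of y z] d_commute[of x z] by (auto simp: profile_def)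

lemma profile_nonneg:
  assumes "profile x y z r s t u"
  shows "s \<ge> 0" "t \<ge> 0" "u \<ge> 0"
  using assms d_triangle[of y z x] d_triangle[of x y z] d_triangle[of x z y] d_commute[of x y] d_commute[of y z] d_commute[of x z]
  by (auto simp: profile_def)

definition nbrs :: "'a \<Rightarrow> 'a \<Rightarrow> 'a \<Rightarrow> int \<Rightarrow> int \<Rightarrow> 'a set" where
  "nbrs x y z a b = {\<xi>. d x \<xi> = 1 \<and> d \<xi> y = d x y + a \<and> d \<xi> z = d x z + b}"

lemma nbrs_union:
  assumes "a = 1 \<or> a = -1"
  shows "{\<xi>. d x \<xi> = 1 \<and> d \<xi> y = d x y + a} = nbrs x y z a 1 \<union> nbrs x y z a (-1)"
    "nbrs x y z a 1 \<inter> nbrs x y z a (-1) = {}"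
  using neighbour_cases[of x _ z] by (auto simp: nbrs_def)

lemma nbrs_swap: "nbrs x y z a b = nbrs x z y b a"
  by (auto simp: nbrs_def)

text \<open>
  The two numbers satisfy two linear equations: their sum is an intersection number, and \<open>balanced\<close>
  gives their sum weighted with \<open>\<theta> (j - 1)\<close> and \<open>\<theta> (j + 1)\<close>.
\<close>

lemma card_nbrs_closer:
  assumes "profile x y z r s t u"
  shows "of_nat (card (nbrs x y z (-1) (-1))) = h * rate s r t u"
    and "of_nat (card (nbrs x y z (-1) 1)) = h * rate t u r s"
proof -
  define i j where "i = s + t" and "j = s + u"
  have ij: "d x y = i" "d x z = j" "d y z = t + u"
    using assms d_commute[of x z] by (auto simp: profile_def i_def j_def)
  let ?mm = "of_nat (card (nbrs x y z (-1) (-1))) :: complex"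
  let ?mp = "of_nat (card (nbrs x y z (-1) 1)) :: complex"
  have "?mm = h * rate s r t u \<and> ?mp = h * rate t u r s"
  proof (cases "x = y")
    case True
    then have "s = 0" "t = 0" using assms profile_nonneg[OF assms] by (auto simp: profile_def)
    moreover have "nbrs x y z (-1) b = {}" for b
      using True by (auto simp: nbrs_def d_commute)
    ultimately show ?thesis by (simp add: rate_def)
  next
    case False
    let ?C = "{\<xi>. d x \<xi> = 1 \<and> d \<xi> y = d x y - 1}"
    have C: "?C = nbrs x y z (-1) 1 \<union> nbrs x y z (-1) (-1)"
      using nbrs_union(1)[of "-1" x y z] by simp
    have "?mp + ?mm = h * qdiff (2 * i) / qsum (int D - 2 * i)"
      using card_closer[of x y] nbrs_union(2)[of "-1" x y z] unfolding C
      by (subst (asm) card_Un_disjoint) (auto simp: ij)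
    then have mp: "?mm + ?mp = h * qdiff (2 * i) / qsum (int D - 2 * i)"
      by (simp only: add.commute)
    have "(\<Sum>w\<in>?C. \<theta> (d w z)) = (\<Sum>w\<in>nbrs x y z (-1) 1. \<theta> (d w z)) + (\<Sum>w\<in>nbrs x y z (-1) (-1). \<theta> (d w z))"
      unfolding C by (rule sum.union_disjoint) (use nbrs_union(2)[of "-1" x y z] in auto)
    also have "\<dots> = ?mp * \<theta> (j + 1) + ?mm * \<theta> (j - 1)"
      by (simp add: nbrs_def ij)
    finally have eq: "?mp * \<theta> (j + 1) + ?mm * \<theta> (j - 1) =
        (h * qdiff (2 * i - 2) * \<theta> j + h * qdiff 2 * \<theta> (t + u)) / qsum (int D - 2 * i)"
      unfolding balanced[OF False] by (simp add: ij h_qdiff add_divide_distrib)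
    let ?c = "h * qdiff (2 * i)" and ?I = "qsum (int D - 2 * i)"
    \<comment> \<open>The determinant of the linear system, up to sign; it does not vanish, even for j = 0 and j = D.\<close>
    have diff: "\<theta> (j - 1) - \<theta> (j + 1) = h * (qdiff 2 * qsum (int D - 2 * j))"
      unfolding qdiff_mult_qsum \<theta>_def using qdiff_minus[of "int D - 2 * j - 2"] by (simp add: algebra_simps)
    have mm: "?mm * (\<theta> (j - 1) - \<theta> (j + 1)) = h * h * (qdiff 2 * (qdiff (2 * s) * qsum (t + u + s - r))) / ?I"
    proof -
      have "?mm * (\<theta> (j - 1) - \<theta> (j + 1))
          = (?mp * \<theta> (j + 1) + ?mm * \<theta> (j - 1)) - (?mm + ?mp) * \<theta> (j + 1)"
        by (simp add: algebra_simps)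
      also have "\<dots> = (h * qdiff (2 * i - 2) * \<theta> j + h * qdiff 2 * \<theta> (t + u) - ?c * \<theta> (j + 1)) / ?I"
        unfolding eq mp by (simp add: diff_divide_distrib)
      also have "h * qdiff (2 * i - 2) * \<theta> j + h * qdiff 2 * \<theta> (t + u) - ?c * \<theta> (j + 1)
          = h * h * (qdiff (2 * i - 2) * qdiff (int D - 2 * j) + qdiff 2 * qdiff (int D - 2 * (t + u))
             - qdiff (2 * i) * qdiff (int D - 2 * (j + 1)))"
        by (simp add: \<theta>_def algebra_simps)
      also have "qdiff (2 * i - 2) * qdiff (int D - 2 * j) + qdiff 2 * qdiff (int D - 2 * (t + u))
             - qdiff (2 * i) * qdiff (int D - 2 * (j + 1)) = qdiff 2 * (qdiff (2 * s) * qsum (t + u + s - r))"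
      proof -
        have D: "int D = r + s + t + u" using assms by (simp add: profile_def)
        show ?thesis
          unfolding qdiff_mult_qdiff qdiff_mult_qsum distrib_left i_def j_def D
          by (simp add: qsum_def algebra_simps)
      qed
      finally show ?thesis .
    qed
    have mp': "?mp * (\<theta> (j - 1) - \<theta> (j + 1)) = h * h * (qdiff 2 * (qdiff (2 * t) * qsum (r + s + t - u))) / ?I"
    proof -
      have "?mp * (\<theta> (j - 1) - \<theta> (j + 1))
          = (?mm + ?mp) * \<theta> (j - 1) - (?mp * \<theta> (j + 1) + ?mm * \<theta> (j - 1))"
        by (simp add: algebra_simps)
      also have "\<dots> = (?c * \<theta> (j - 1) - (h * qdiff (2 * i - 2) * \<theta> j + h * qdiff 2 * \<theta> (t + u))) / ?I"
        unfolding eq mp by (simp add: diff_divide_distrib)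
      also have "?c * \<theta> (j - 1) - (h * qdiff (2 * i - 2) * \<theta> j + h * qdiff 2 * \<theta> (t + u))
          = h * h * (qdiff (2 * i) * qdiff (int D - 2 * (j - 1)) - qdiff (2 * i - 2) * qdiff (int D - 2 * j)
             - qdiff 2 * qdiff (int D - 2 * (t + u)))"
        by (simp add: \<theta>_def algebra_simps)
      also have "qdiff (2 * i) * qdiff (int D - 2 * (j - 1)) - qdiff (2 * i - 2) * qdiff (int D - 2 * j)
             - qdiff 2 * qdiff (int D - 2 * (t + u)) = qdiff 2 * (qdiff (2 * t) * qsum (r + s + t - u))"
      proof -
        have D: "int D = r + s + t + u" using assms by (simp add: profile_def)
        show ?thesis
          unfolding qdiff_mult_qdiff qdiff_mult_qsum distrib_left i_def j_def D
          by (simp add: qsum_def algebra_simps)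
      qed
      finally show ?thesis .
    qed
    have nz: "h * qdiff 2 \<noteq> 0" by (simp add: h_qdiff)
    have cancel: "m = h * (a / (I * J))"
      if "m * (h * (qdiff 2 * J)) = h * h * (qdiff 2 * a) / I" "I \<noteq> 0" "J \<noteq> 0" for m a I J
      using that nz by (simp add: field_simps)
    have D: "int D = r + s + t + u" using assms by (simp add: profile_def)
    have "?mm = h * (qdiff (2 * s) * qsum (t + u + s - r) / (?I * qsum (int D - 2 * j)))"
      using mm unfolding diff by (intro cancel) simp_all
    moreover have "?mp = h * (qdiff (2 * t) * qsum (r + s + t - u) / (?I * qsum (int D - 2 * j)))"
      using mp' unfolding diff by (intro cancel) simp_all
    moreover have "qsum (int D - 2 * i) = qsum (s + t - r - u)" "qsum (int D - 2 * j) = qsum (s + u - r - t)"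
       "qsum (int D - 2 * i) = qsum (t + s - u - r)" "qsum (int D - 2 * j) = qsum (t + r - u - s)"
      using qsum_minus[of "s + t - r - u"] qsum_minus[of "s + u - r - t"] qsum_minus[of "t + s - u - r"]
      by (simp_all add: D i_def j_def algebra_simps)
    ultimately show ?thesis by (simp add: rate_def mult.commute)
  qed
  then show "?mm = h * rate s r t u" "?mp = h * rate t u r s" by auto
qed

lemma rate_add: "rate a b c e + rate e c b a = qdiff (2 * (a + e)) / qsum (a + e - b - c)"
proof -
  have "qdiff (2 * a) * qsum (c + e + a - b) + qdiff (2 * e) * qsum (b + a + e - c) = qdiff (2 * (a + e)) * qsum (a + c - b - e)"
    unfolding qdiff_mult_qsum by (simp add: qdiff_def algebra_simps)
  moreover have "qsum (e + b - c - a) = qsum (a + c - b - e)"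
    using qsum_minus[of "a + c - b - e"] by (simp add: algebra_simps)
  moreover have "qsum (e + a - c - b) = qsum (a + e - b - c)" by (simp add: algebra_simps)
  ultimately have "rate a b c e + rate e c b a = qdiff (2 * (a + e)) * qsum (a + c - b - e) / (qsum (a + c - b - e) * qsum (a + e - b - c))"
    by (simp add: rate_def flip: add_divide_distrib)
  then show ?thesis by simp
qed

text \<open>
  The first number is covered by \<open>card_nbrs_closer\<close> with \<open>y\<close> and \<open>z\<close> exchanged; the second one
  is then found from the intersection number for a growing distance to \<open>y\<close>.
\<close>

lemma card_nbrs_farther:
  assumes "profile x y z r s t u"
  shows "of_nat (card (nbrs x y z 1 (-1))) = h * rate u t r s"
    and "of_nat (card (nbrs x y z 1 1)) = h * rate r s t u"
proof -
  have D: "int D = r + s + t + u" and xy: "d x y = s + t" using assms by (simp_all add: profile_def)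
  show 1: "of_nat (card (nbrs x y z 1 (-1))) = h * rate u t r s"
    using card_nbrs_closer(2)[of x z y r s u t] assms profile_swap23[of x y z]
    by (simp add: nbrs_swap[of x y])
  have C: "{\<xi>. d x \<xi> = 1 \<and> d \<xi> y = d x y + 1} = nbrs x y z 1 1 \<union> nbrs x y z 1 (-1)"
    using nbrs_union(1)[of 1 x y z] by simp
  have "of_nat (card (nbrs x y z 1 1)) + of_nat (card (nbrs x y z 1 (-1)))
      = h * (qdiff (2 * (r + u)) / qsum (r + u - s - t))"
    using card_farther[of x y] nbrs_union(2)[of 1 x y z] unfolding C
    by (subst (asm) card_Un_disjoint) (auto simp: xy D algebra_simps)
  also have "\<dots> = h * rate r s t u + h * rate u t s r"
    unfolding rate_add[symmetric] by (simp add: distrib_left)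
  also have "rate u t s r = rate u t r s" by (simp add: rate_def algebra_simps)
  finally show "of_nat (card (nbrs x y z 1 1)) = h * rate r s t u"
    using 1 by simp
qed

lemma profile_neighbour:
  assumes "profile x y z r s t u"
  shows "\<xi> \<in> nbrs x y z 1 1 \<Longrightarrow> profile \<xi> y z (r - 1) (s + 1) t u"
    and "\<xi> \<in> nbrs x y z (-1) (-1) \<Longrightarrow> profile \<xi> y z (r + 1) (s - 1) t u"
    and "\<xi> \<in> nbrs x y z (-1) 1 \<Longrightarrow> profile \<xi> y z r s (t - 1) (u + 1)"
    and "\<xi> \<in> nbrs x y z 1 (-1) \<Longrightarrow> profile \<xi> y z r s (t + 1) (u - 1)"
  using assms d_commute[of x z] d_commute[of \<xi> z] by (auto simp: profile_def nbrs_def)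

lemma neighbourhood_split:
  "{\<xi>. d x \<xi> = 1} = (nbrs x y z 1 1 \<union> nbrs x y z (-1) (-1)) \<union> (nbrs x y z (-1) 1 \<union> nbrs x y z 1 (-1))"
  using neighbour_cases[of x _ y] neighbour_cases[of x _ z] by (fastforce simp: nbrs_def)

text \<open>
  The claim is transported along a shortest path from \<open>y\<close> to \<open>x\<close>.  The only danger is that \<open>r\<close> becomes
  negative, which would need a step from a triple with \<open>r = 0\<close> to a vertex farther from both \<open>y\<close> and
  \<open>z\<close>; by \<open>card_nbrs_farther\<close> the number of such steps is a multiple of \<open>rate 0 s t u = 0\<close>.
\<close>

lemma profile_exists: "\<exists>r s t u. profile x y z r s t u \<and> r \<ge> 0"
proof (induction "nat (d x y)" arbitrary: x)
  case 0
  then have "x = y" using d_nonneg[of x y] d_eq_0_iff[of x y] by linarith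
  moreover have "d y z \<le> int D"
    using gdist_le_diameter[OF conn, of y z] by (simp add: d_def D_diam)
  ultimately have "profile x y z (int D - d y z) 0 0 (d y z) \<and> int D - d y z \<ge> 0"
    by (auto simp: profile_def d_commute)
  then show ?case by blast
next
  case (Suc n)
  then have xy: "d x y = int n + 1" by linarith
  have "of_nat (card {\<xi>. d x \<xi> = 1 \<and> d \<xi> y = d x y - 1}) \<noteq> (0 :: complex)"
    unfolding card_closer using xy h_nonzero by (simp add: qdiff_eq_0_iff)
  then have "{\<xi>. d x \<xi> = 1 \<and> d \<xi> y = d x y - 1} \<noteq> {}"
    by (metis card.empty of_nat_0)
  then obtain \<xi> where \<xi>: "d x \<xi> = 1" "d \<xi> y = int n" using xy by auto
  with Suc(1)[of \<xi>] obtain r s t u where p: "profile \<xi> y z r s t u" and r: "r \<ge> 0" by auto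
  have x: "x \<in> {\<xi>'. d \<xi> \<xi>' = 1}" using \<xi> by (simp add: d_commute)
  have "x \<notin> nbrs \<xi> y z 1 1" if "r = 0"
  proof
    assume "x \<in> nbrs \<xi> y z 1 1"
    then have "card (nbrs \<xi> y z 1 1) \<noteq> 0" by auto
    moreover have "of_nat (card (nbrs \<xi> y z 1 1)) = (0 :: complex)"
      unfolding card_nbrs_farther(2)[OF p] by (simp add: that rate_def)
    ultimately show False by simp
  qed
  then show ?case
    using x profile_neighbour[OF p, of x] r
    unfolding neighbourhood_split[of \<xi> y z]
    by (cases "r = 0") (blast | smt (verit) UnE)+
qed

lemma sum_neighbours:
  assumes p: "profile x y z r s t u"
    and G: "\<And>\<xi> r s t u. profile \<xi> y z r s t u \<Longrightarrow> G \<xi> = F r s t u"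
  shows "(\<Sum>\<xi>\<in>{\<xi>. d x \<xi> = 1}. G \<xi>) = h * L1 F r s t u"
proof -
  have disj: "nbrs x y z a b \<inter> nbrs x y z a' b' = {}" if "a \<noteq> a' \<or> b \<noteq> b'" for a b a' b'
    using that by (auto simp: nbrs_def)
  have const: "(\<Sum>\<xi>\<in>nbrs x y z a b. G \<xi>) = of_nat (card (nbrs x y z a b)) * c"
    if "\<And>\<xi>. \<xi> \<in> nbrs x y z a b \<Longrightarrow> G \<xi> = c" for a b c
    using that by simp
  have "(\<Sum>\<xi>\<in>{\<xi>. d x \<xi> = 1}. G \<xi>) =
      ((\<Sum>\<xi>\<in>nbrs x y z 1 1. G \<xi>) + (\<Sum>\<xi>\<in>nbrs x y z (-1) (-1). G \<xi>))
      + ((\<Sum>\<xi>\<in>nbrs x y z (-1) 1. G \<xi>) + (\<Sum>\<xi>\<in>nbrs x y z 1 (-1). G \<xi>))"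
    unfolding neighbourhood_split[of x y z]
    by (subst sum.union_disjoint | simp add: Int_Un_distrib Int_Un_distrib2 disj)+
  also have "\<dots> = h * L1 F r s t u"
    using const[OF G[OF profile_neighbour(1)[OF p]]] const[OF G[OF profile_neighbour(2)[OF p]]]
      const[OF G[OF profile_neighbour(3)[OF p]]] const[OF G[OF profile_neighbour(4)[OF p]]]
    by (simp add: card_nbrs_closer[OF p] card_nbrs_farther[OF p] L1_def distrib_left mult.assoc)
  finally show ?thesis .
qed

end

section \<open>Tridiagonal relations between adjacency and distance\<close>

context two_homogeneous
begin

text \<open>
  With this constant, the normalised maps of the theorem are \<open>\<kappa> / h\<close> times the adjacency maps and
  \<open>- \<kappa> / h\<close> times the dual maps; \<open>\<phi> i\<close> is the normalised dual eigenvalue.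
\<close>

definition \<kappa> :: complex where "\<kappa> = \<i> / qdiff 2"
definition \<phi> :: "int \<Rightarrow> complex" where "\<phi> i = - \<kappa> * qdiff (int D - 2 * i)"
definition nbr_sum :: "('a \<Rightarrow> complex) \<Rightarrow> 'a \<Rightarrow> complex" where
  "nbr_sum f x = \<kappa> / h * (\<Sum>\<xi>\<in>{\<xi>. d x \<xi> = 1}. f \<xi>)"

lemma qdiff_2_nonzero: "qdiff 2 \<noteq> 0" by (simp add: qdiff_eq_0_iff)
lemma \<kappa>_square: "\<kappa> * \<kappa> * (qdiff 2 * qdiff 2) = - 1" using qdiff_2_nonzero by (simp add: \<kappa>_def)
lemma \<phi>_eq: "\<phi> i = - (\<kappa> / h) * \<theta> i" using h_nonzero by (simp add: \<phi>_def \<theta>_def)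

lemma nbr_sum_add: "nbr_sum (\<lambda>\<xi>. f \<xi> + g \<xi>) x = nbr_sum f x + nbr_sum g x"
  by (simp add: nbr_sum_def sum.distrib distrib_left)
lemma nbr_sum_diff: "nbr_sum (\<lambda>\<xi>. f \<xi> - g \<xi>) x = nbr_sum f x - nbr_sum g x"
  by (simp add: nbr_sum_def sum_subtractf right_diff_distrib)
lemma nbr_sum_mult: "nbr_sum (\<lambda>\<xi>. c * f \<xi>) x = c * nbr_sum f x"
  by (simp add: nbr_sum_def mult.left_commute flip: sum_distrib_left)

text \<open>
  The cubic relations rest on this quadratic equation between consecutive normalised eigenvalues.  It
  is the addition theorem for the hyperbolic sine, written in terms of \<open>q\<close>.
\<close>

lemma \<phi>_step:
  assumes "j = i - 1 \<or> j = i + 1"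
  shows "\<phi> i * \<phi> i - qsum 2 * (\<phi> i * \<phi> j) + \<phi> j * \<phi> j = - 1"
proof -
  have *: "qdiff e * qdiff e - qsum 2 * (qdiff e * qdiff e') + qdiff e' * qdiff e' = qdiff 2 * qdiff 2" if "e' = e + 2 \<or> e' = e - 2" for e e'
    using that
  proof
    assume e: "e' = e + 2"
    have "qsum 2 * (qdiff e * qdiff (e + 2)) = qsum 2 * qsum (2 * e + 2) - qsum 2 * qsum (- 2)"
      unfolding qdiff_mult_qdiff by (simp add: algebra_simps)
    then show ?thesis unfolding e qdiff_mult_qdiff qsum_mult_qsum using qsum_minus[of "2 * e"] by (simp add: algebra_simps)
  next
    assume e: "e' = e - 2"
    have "qsum 2 * (qdiff e * qdiff (e - 2)) = qsum 2 * qsum (2 * e - 2) - qsum 2 * qsum 2"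
      unfolding qdiff_mult_qdiff by (simp add: algebra_simps)
    then show ?thesis unfolding e qdiff_mult_qdiff qsum_mult_qsum using qsum_minus[of "4 - 2 * e"] by (simp add: algebra_simps)
  qed
  have "\<phi> i * \<phi> i - qsum 2 * (\<phi> i * \<phi> j) + \<phi> j * \<phi> j
     = \<kappa> * \<kappa> * (qdiff (int D - 2 * i) * qdiff (int D - 2 * i) - qsum 2 * (qdiff (int D - 2 * i) * qdiff (int D - 2 * j))
         + qdiff (int D - 2 * j) * qdiff (int D - 2 * j))"
    by (simp add: \<phi>_def algebra_simps)
  also have "\<dots> = \<kappa> * \<kappa> * (qdiff 2 * qdiff 2)"
    by (subst *) (use assms in auto)
  finally show ?thesis by (simp add: \<kappa>_square)
qed

text \<open>
  The relation of the algebra in which the distance map \<open>\<phi> (d x y)\<close> occurs twice: up to the factor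
  \<open>\<kappa> / h\<close>, the coefficient of \<open>f \<xi>\<close> is the left side of \<open>\<phi>_step\<close> for the distances of \<open>x\<close> and \<open>\<xi>\<close> to \<open>y\<close>.
\<close>

lemma diagonal_relation:
  "\<phi> (d x y) * (\<phi> (d x y) * nbr_sum f x) - qsum 2 * (\<phi> (d x y) * nbr_sum (\<lambda>\<xi>. \<phi> (d \<xi> y) * f \<xi>) x)
    + nbr_sum (\<lambda>\<xi>. \<phi> (d \<xi> y) * (\<phi> (d \<xi> y) * f \<xi>)) x = - nbr_sum f x"
proof -
  have "\<phi> (d x y) * (\<phi> (d x y) * nbr_sum f x) - qsum 2 * (\<phi> (d x y) * nbr_sum (\<lambda>\<xi>. \<phi> (d \<xi> y) * f \<xi>) x)
      + nbr_sum (\<lambda>\<xi>. \<phi> (d \<xi> y) * (\<phi> (d \<xi> y) * f \<xi>)) x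
    = nbr_sum (\<lambda>\<xi>. \<phi> (d x y) * (\<phi> (d x y) * f \<xi>) - qsum 2 * (\<phi> (d x y) * (\<phi> (d \<xi> y) * f \<xi>))
        + \<phi> (d \<xi> y) * (\<phi> (d \<xi> y) * f \<xi>)) x"
    by (simp add: nbr_sum_add nbr_sum_diff nbr_sum_mult)
  also have "\<dots> = nbr_sum (\<lambda>\<xi>. - 1 * f \<xi>) x"
    unfolding nbr_sum_def
  proof (intro arg_cong[where f = "\<lambda>a. \<kappa> / h * a"] sum.cong refl)
    fix \<xi> assume "\<xi> \<in> {\<xi>. d x \<xi> = 1}"
    then have "\<phi> (d x y) * \<phi> (d x y) - qsum 2 * (\<phi> (d x y) * \<phi> (d \<xi> y)) + \<phi> (d \<xi> y) * \<phi> (d \<xi> y) = - 1"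
      by (intro \<phi>_step neighbour_cases) simp
    then show "\<phi> (d x y) * (\<phi> (d x y) * f \<xi>) - qsum 2 * (\<phi> (d x y) * (\<phi> (d \<xi> y) * f \<xi>))
        + \<phi> (d \<xi> y) * (\<phi> (d \<xi> y) * f \<xi>) = - 1 * f \<xi>"
      unfolding mult.assoc[symmetric] distrib_right[symmetric] left_diff_distrib[symmetric] by (simp only:)
  qed
  also have "\<dots> = - nbr_sum f x" by (subst nbr_sum_mult) simp
  finally show ?thesis .
qed

lemma card_neighbours: "of_nat (card {\<xi>. d x \<xi> = 1}) = h * qdiff (int D)"
proof -
  have "{\<xi>. d x \<xi> = 1 \<and> d \<xi> x = d x x + 1} = {\<xi>. d x \<xi> = 1}" by (auto simp: d_commute)
  then have "of_nat (card {\<xi>. d x \<xi> = 1}) = h * qdiff (2 * int D) / qsum (int D)"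
    using card_farther[of x x] by simp
  also have "qdiff (2 * int D) = qdiff (int D) * qsum (int D)" by (simp add: qdiff_mult_qsum)
  finally show ?thesis by simp
qed

lemma sum_\<theta>_neighbours: "(\<Sum>\<xi>\<in>{\<xi>. d x \<xi> = 1}. \<theta> (d \<xi> y)) = h * qdiff (int D - 2) * \<theta> (d x y)"
proof -
  define i where "i = d x y"
  let ?A = "{\<xi>. d x \<xi> = 1 \<and> d \<xi> y = d x y - 1}" and ?B = "{\<xi>. d x \<xi> = 1 \<and> d \<xi> y = d x y + 1}"
  have "{\<xi>. d x \<xi> = 1} = ?A \<union> ?B" using neighbour_cases[of x _ y] by auto
  then have "(\<Sum>\<xi>\<in>{\<xi>. d x \<xi> = 1}. \<theta> (d \<xi> y)) = (\<Sum>\<xi>\<in>?A. \<theta> (d \<xi> y)) + (\<Sum>\<xi>\<in>?B. \<theta> (d \<xi> y))"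
    by (simp only:) (rule sum.union_disjoint, auto)
  also have "\<dots> = of_nat (card ?A) * \<theta> (i - 1) + of_nat (card ?B) * \<theta> (i + 1)"
    by (simp add: i_def)
  also have "\<dots> = h * h * (qdiff (2 * i) * qdiff (int D - 2 * (i - 1)) + qdiff (2 * (int D - i)) * qdiff (int D - 2 * (i + 1))) / qsum (int D - 2 * i)"
    unfolding card_closer card_farther by (simp add: i_def \<theta>_def add_divide_distrib distrib_left mult.assoc mult.left_commute)
  also have "qdiff (2 * i) * qdiff (int D - 2 * (i - 1)) + qdiff (2 * (int D - i)) * qdiff (int D - 2 * (i + 1))
      = qdiff (int D - 2) * qdiff (2 * (int D - 2 * i))"
    unfolding qdiff_mult_qdiff using qsum_minus[of "int D + 2 - 4 * i"] by (simp add: algebra_simps)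
  also have "qdiff (2 * (int D - 2 * i)) = qdiff (int D - 2 * i) * qsum (int D - 2 * i)"
    by (simp add: qdiff_mult_qsum)
  finally show ?thesis by (simp add: \<theta>_def i_def)
qed

text \<open>
  The relation of the algebra in which the adjacency map occurs twice.  The left side is a sum over
  walks \<open>x, \<xi>, \<eta>\<close>.  The walks that end in a fixed \<open>\<eta>\<close> at distance 2 from \<open>x\<close> contribute nothing, by
  \<open>balanced\<close> for \<open>x\<close> and \<open>\<eta>\<close>; the walks that return to \<open>x\<close> yield the right side.
\<close>

lemma adjacency_relation:
  "nbr_sum (\<lambda>\<xi>. nbr_sum (\<lambda>\<eta>. \<phi> (d \<eta> y) * f \<eta>) \<xi>) x - qsum 2 * nbr_sum (\<lambda>\<xi>. \<phi> (d \<xi> y) * nbr_sum f \<xi>) x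
    + \<phi> (d x y) * nbr_sum (\<lambda>\<xi>. nbr_sum f \<xi>) x = - (\<phi> (d x y) * f x)"
proof -
  define g where "g \<eta> \<xi> = \<phi> (d \<eta> y) + \<phi> (d x y) - qsum 2 * \<phi> (d \<xi> y)" for \<eta> \<xi>
  let ?C = "\<lambda>\<eta>. {\<xi>. \<xi> \<in> {\<xi>. d x \<xi> = 1} \<and> d \<xi> \<eta> = 1}"
  have "nbr_sum (\<lambda>\<xi>. nbr_sum (\<lambda>\<eta>. \<phi> (d \<eta> y) * f \<eta>) \<xi>) x - qsum 2 * nbr_sum (\<lambda>\<xi>. \<phi> (d \<xi> y) * nbr_sum f \<xi>) x
      + \<phi> (d x y) * nbr_sum (\<lambda>\<xi>. nbr_sum f \<xi>) x
    = nbr_sum (\<lambda>\<xi>. nbr_sum (\<lambda>\<eta>. g \<eta> \<xi> * f \<eta>) \<xi>) x"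
    by (simp add: g_def left_diff_distrib distrib_right nbr_sum_add nbr_sum_diff nbr_sum_mult mult.assoc)
  also have "\<dots> = (\<kappa> / h) * (\<kappa> / h) * (\<Sum>\<xi>\<in>{\<xi>. d x \<xi> = 1}. \<Sum>\<eta>\<in>{\<eta>. \<eta> \<in> UNIV \<and> d \<xi> \<eta> = 1}. g \<eta> \<xi> * f \<eta>)"
    by (simp add: nbr_sum_def sum_distrib_left mult.assoc)
  also have "\<dots> = (\<kappa> / h) * (\<kappa> / h) * (\<Sum>\<eta>\<in>UNIV. \<Sum>\<xi>\<in>?C \<eta>. g \<eta> \<xi> * f \<eta>)"
    by (subst sum.swap_restrict) simp_all
  also have "\<dots> = (\<Sum>\<eta>\<in>UNIV. if \<eta> = x then - (\<phi> (d x y) * f x) else 0)"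
    unfolding sum_distrib_left[of _ _ UNIV]
  proof (intro sum.cong refl)
    fix \<eta>
    have pull: "(\<Sum>\<xi>\<in>?C \<eta>. g \<eta> \<xi> * f \<eta>) = (\<Sum>\<xi>\<in>?C \<eta>. g \<eta> \<xi>) * f \<eta>"
      by (simp add: sum_distrib_right)
    have sum_g: "(\<Sum>\<xi>\<in>?C \<eta>. g \<eta> \<xi>)
        = of_nat (card (?C \<eta>)) * (\<phi> (d \<eta> y) + \<phi> (d x y)) + qsum 2 * (\<kappa> / h) * (\<Sum>\<xi>\<in>?C \<eta>. \<theta> (d \<xi> y))"
    proof -
      have "g \<eta> \<xi> = (\<phi> (d \<eta> y) + \<phi> (d x y)) + qsum 2 * (\<kappa> / h) * \<theta> (d \<xi> y)" for \<xi>
        by (simp add: g_def \<phi>_eq[of "d \<xi> y"])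
      then show ?thesis
        by (simp only: sum.distrib sum_constant sum_distrib_left distrib_left)
    qed
    consider "\<eta> = x" | "\<eta> \<noteq> x" "?C \<eta> = {}" | \<xi> where "\<eta> \<noteq> x" "\<xi> \<in> ?C \<eta>" by blast
    then show "(\<kappa> / h) * (\<kappa> / h) * (\<Sum>\<xi>\<in>?C \<eta>. g \<eta> \<xi> * f \<eta>) = (if \<eta> = x then - (\<phi> (d x y) * f x) else 0)"
    proof cases
      case 1
      then have "?C \<eta> = {\<xi>. d x \<xi> = 1}" by (auto simp: d_commute)
      then have "(\<Sum>\<xi>\<in>?C \<eta>. g \<eta> \<xi>)
          = h * qdiff (int D) * (\<phi> (d x y) + \<phi> (d x y)) + qsum 2 * (\<kappa> / h) * (h * qdiff (int D - 2) * \<theta> (d x y))"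
        using 1 unfolding sum_g by (simp only: card_neighbours sum_\<theta>_neighbours)
      also have "\<dots> = h * (2 * qdiff (int D) - qdiff (int D - 2) * qsum 2) * \<phi> (d x y)"
        unfolding \<phi>_eq by (simp add: algebra_simps)
      also have "2 * qdiff (int D) - qdiff (int D - 2) * qsum 2 = qdiff 2 * qsum (int D - 2)"
        unfolding qdiff_mult_qsum using qdiff_minus[of "int D - 4"] by (simp add: algebra_simps)
      also have "\<dots> = h * (qdiff 2 * qdiff 2)" by (simp flip: h_qdiff)
      finally have "(\<Sum>\<xi>\<in>?C \<eta>. g \<eta> \<xi>) = h * h * (qdiff 2 * qdiff 2) * \<phi> (d x y)" by simp
      then have "(\<kappa> / h) * (\<kappa> / h) * (\<Sum>\<xi>\<in>?C \<eta>. g \<eta> \<xi> * f \<eta>) = \<kappa> * \<kappa> * (qdiff 2 * qdiff 2) * (\<phi> (d x y) * f x)"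
        unfolding pull using 1 h_nonzero by simp
      then show ?thesis using 1 by (simp add: \<kappa>_square)
    next
      case 2
      then show ?thesis by (simp only: sum.empty) simp
    next
      case 3
      then have "d x \<eta> = 2"
        using dist_between_neighbours[of \<xi> x \<eta>] d_commute[of x \<xi>] by simp
      then have C: "?C \<eta> = {\<xi>. d x \<xi> = 1 \<and> d \<xi> \<eta> = d x \<eta> - 1}" by auto
      have c: "of_nat (card (?C \<eta>)) = h * qdiff 4 / qsum (int D - 4)"
        using card_closer[of x \<eta>] \<open>d x \<eta> = 2\<close> unfolding C by simp
      have "(\<Sum>\<xi>\<in>?C \<eta>. \<theta> (d \<xi> y)) = h * qdiff 2 / qsum (int D - 4) * (\<theta> (d x y) + \<theta> (d \<eta> y))"
        using balanced[of x \<eta> y] 3(1) \<open>d x \<eta> = 2\<close> unfolding C by (simp add: h_qdiff distrib_left)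
      moreover have "qdiff 4 = qsum 2 * qdiff 2" using qdiff_mult_qsum[of 2 2] by (simp add: mult.commute)
      ultimately have "(\<Sum>\<xi>\<in>?C \<eta>. g \<eta> \<xi>) = 0"
        unfolding sum_g c by (simp add: \<phi>_eq algebra_simps flip: add_divide_distrib)
      then show ?thesis unfolding pull using 3 by simp
    qed
  qed
  also have "\<dots> = - (\<phi> (d x y) * f x)" by simp
  finally show ?thesis .
qed

end

section \<open>\<open>q\<close>-commutators of linear maps\<close>

definition op_bracket ::
  "complex \<Rightarrow> (complex ^ 'n \<Rightarrow> complex ^ 'n) \<Rightarrow> (complex ^ 'n \<Rightarrow> complex ^ 'n) \<Rightarrow> complex ^ 'n \<Rightarrow> complex ^ 'n" where
  "op_bracket c X Y v = c *s X (Y v) - inverse c *s Y (X v)"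

definition linear_op :: "(complex ^ 'n \<Rightarrow> complex ^ 'n) \<Rightarrow> bool" where
  "linear_op X \<longleftrightarrow> (\<forall>v w. X (v + w) = X v + X w) \<and> (\<forall>c v. X (c *s v) = c *s X v)"

lemma linear_op_add: "linear_op X \<Longrightarrow> X (v + w) = X v + X w"
  and linear_op_scale: "linear_op X \<Longrightarrow> X (c *s v) = c *s X v"
  by (simp_all add: linear_op_def)

lemma linear_op_uminus: "linear_op X \<Longrightarrow> X (- v) = - X v"
  using linear_op_scale[of X "-1" v] by simp

lemma linear_op_diff: "linear_op X \<Longrightarrow> X (v - w) = X v - X w"
  using linear_op_add[of X v "- w"] by (simp add: linear_op_uminus)

lemma linear_op_bracket:
  assumes "linear_op X" "linear_op Y"
  shows "linear_op (op_bracket c X Y)"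
  unfolding linear_op_def[of "op_bracket c X Y"] op_bracket_def
    linear_op_add[OF assms(1)] linear_op_add[OF assms(2)] linear_op_scale[OF assms(1)] linear_op_scale[OF assms(2)]
  by (simp add: vec_eq_iff algebra_simps)

context not_root_of_unity
begin

lemma qsum_2: "qsum 2 = q * q + inverse q * inverse q"
  by (simp add: qsum_def power_int_minus power2_eq_square)

lemma op_bracket_bracket:
  assumes "linear_op X" "linear_op Y"
  shows "op_bracket q X (op_bracket q Y X) v = qsum 2 *s X (Y (X v)) - X (X (Y v)) - Y (X (X v))"
  using q_nonzero by (simp add: op_bracket_def linear_op_diff[OF assms(1)] linear_op_diff[OF assms(2)]
      linear_op_scale[OF assms(1)] linear_op_scale[OF assms(2)] qsum_2 vec_eq_iff algebra_simps)

text \<open>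
  The nested \<open>q\<close>-commutator on the left acts on \<open>Y = op_bracket q S A\<close> by the expression in
  \<open>op_bracket_bracket\<close>, which is linear in \<open>Y\<close>.  Since \<open>S\<close> commutes with \<open>P\<close>, it fixes the products of \<open>S\<close> and
  \<open>A\<close> in either order, because it fixes \<open>A\<close>.
\<close>

lemma op_bracket_bracket_commuting:
  assumes lin: "linear_op A" "linear_op P" "linear_op S"
    and comm: "\<And>v. P (S v) = S (P v)"
    and rel: "\<And>v. P (P (A v)) - qsum 2 *s P (A (P v)) + A (P (P v)) = - A v"
  shows "op_bracket q P (op_bracket q (op_bracket q S A) P) v = op_bracket q S A v"
proof -
  note L = linear_op_diff[OF lin(1)] linear_op_diff[OF lin(2)] linear_op_diff[OF lin(3)]
    linear_op_scale[OF lin(1)] linear_op_scale[OF lin(2)] linear_op_scale[OF lin(3)]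
    linear_op_uminus[OF lin(1)] linear_op_uminus[OF lin(2)] linear_op_uminus[OF lin(3)]
    linear_op_add[OF lin(1)] linear_op_add[OF lin(2)] linear_op_add[OF lin(3)]
  have rel': "A v = qsum 2 *s P (A (P v)) - P (P (A v)) - A (P (P v))" for v
  proof -
    have "A v = - (P (P (A v)) - qsum 2 *s P (A (P v)) + A (P (P v)))"
      unfolding rel by simp
    then show ?thesis by (simp add: algebra_simps)
  qed
  have "op_bracket q P (op_bracket q (op_bracket q S A) P) v
      = qsum 2 *s P (op_bracket q S A (P v)) - P (P (op_bracket q S A v)) - op_bracket q S A (P (P v))"
    by (rule op_bracket_bracket) (intro linear_op_bracket lin)+
  also have "\<dots> = q *s S (qsum 2 *s P (A (P v)) - P (P (A v)) - A (P (P v)))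
     - inverse q *s (qsum 2 *s P (A (P (S v))) - P (P (A (S v))) - A (P (P (S v))))"
    by (simp add: op_bracket_def L comm vec_eq_iff algebra_simps)
  also have "\<dots> = op_bracket q S A v"
    by (simp only: rel'[symmetric] op_bracket_def)
  finally show ?thesis .
qed

end

section \<open>The six maps on the tensor cube and on functions of the profile\<close>

context two_homogeneous
begin

text \<open>
  The six maps, normalised such that they represent generators of the algebra: \<open>A\<^sub>1, A\<^sub>2, A\<^sub>3\<close> for
  the adjacency maps and \<open>P\<^sub>1, P\<^sub>2, P\<^sub>3\<close> for the dual ones, which are diagonal.
\<close>

definition A\<^sub>1 :: "complex ^ ('a \<times> 'a \<times> 'a) \<Rightarrow> complex ^ ('a \<times> 'a \<times> 'a)" where
  "A\<^sub>1 v = (\<chi> p. case p of (x, y, z) \<Rightarrow> nbr_sum (\<lambda>\<xi>. v $ (\<xi>, y, z)) x)"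
definition A\<^sub>2 :: "complex ^ ('a \<times> 'a \<times> 'a) \<Rightarrow> complex ^ ('a \<times> 'a \<times> 'a)" where
  "A\<^sub>2 v = (\<chi> p. case p of (x, y, z) \<Rightarrow> nbr_sum (\<lambda>\<xi>. v $ (x, \<xi>, z)) y)"
definition A\<^sub>3 :: "complex ^ ('a \<times> 'a \<times> 'a) \<Rightarrow> complex ^ ('a \<times> 'a \<times> 'a)" where
  "A\<^sub>3 v = (\<chi> p. case p of (x, y, z) \<Rightarrow> nbr_sum (\<lambda>\<xi>. v $ (x, y, \<xi>)) z)"
definition P\<^sub>1 :: "complex ^ ('a \<times> 'a \<times> 'a) \<Rightarrow> complex ^ ('a \<times> 'a \<times> 'a)" where
  "P\<^sub>1 v = (\<chi> p. case p of (x, y, z) \<Rightarrow> \<phi> (d y z) * v $ (x, y, z))"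
definition P\<^sub>2 :: "complex ^ ('a \<times> 'a \<times> 'a) \<Rightarrow> complex ^ ('a \<times> 'a \<times> 'a)" where
  "P\<^sub>2 v = (\<chi> p. case p of (x, y, z) \<Rightarrow> \<phi> (d z x) * v $ (x, y, z))"
definition P\<^sub>3 :: "complex ^ ('a \<times> 'a \<times> 'a) \<Rightarrow> complex ^ ('a \<times> 'a \<times> 'a)" where
  "P\<^sub>3 v = (\<chi> p. case p of (x, y, z) \<Rightarrow> \<phi> (d x y) * v $ (x, y, z))"

lemma maps_nth [simp]:
  "A\<^sub>1 v $ (x, y, z) = nbr_sum (\<lambda>\<xi>. v $ (\<xi>, y, z)) x"
  "A\<^sub>2 v $ (x, y, z) = nbr_sum (\<lambda>\<xi>. v $ (x, \<xi>, z)) y"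
  "A\<^sub>3 v $ (x, y, z) = nbr_sum (\<lambda>\<xi>. v $ (x, y, \<xi>)) z"
  "P\<^sub>1 v $ (x, y, z) = \<phi> (d y z) * v $ (x, y, z)"
  "P\<^sub>2 v $ (x, y, z) = \<phi> (d z x) * v $ (x, y, z)"
  "P\<^sub>3 v $ (x, y, z) = \<phi> (d x y) * v $ (x, y, z)"
  by (simp_all add: A\<^sub>1_def A\<^sub>2_def A\<^sub>3_def P\<^sub>1_def P\<^sub>2_def P\<^sub>3_def)

lemma linear_maps: "linear_op A\<^sub>1" "linear_op A\<^sub>2" "linear_op A\<^sub>3" "linear_op P\<^sub>1" "linear_op P\<^sub>2" "linear_op P\<^sub>3"
  by (simp_all add: linear_op_def vec_eq_iff split_paired_all nbr_sum_add nbr_sum_mult distrib_left mult.left_commute)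

definition q_serre :: "(complex ^ ('a \<times> 'a \<times> 'a) \<Rightarrow> complex ^ ('a \<times> 'a \<times> 'a)) \<Rightarrow>
    (complex ^ ('a \<times> 'a \<times> 'a) \<Rightarrow> complex ^ ('a \<times> 'a \<times> 'a)) \<Rightarrow> bool" where
  "q_serre X Y \<longleftrightarrow> (\<forall>v. X (X (Y v)) - qsum 2 *s X (Y (X v)) + Y (X (X v)) = - Y v)"

text \<open>
  The same relations for a moving vertex in the second argument of the distance.
\<close>

lemma diagonal_relation':
  "\<phi> (d y x) * (\<phi> (d y x) * nbr_sum f x) - qsum 2 * (\<phi> (d y x) * nbr_sum (\<lambda>\<xi>. \<phi> (d y \<xi>) * f \<xi>) x)
    + nbr_sum (\<lambda>\<xi>. \<phi> (d y \<xi>) * (\<phi> (d y \<xi>) * f \<xi>)) x = - nbr_sum f x"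
  using diagonal_relation[of x y f] by (simp only: d_commute[of y])

lemma adjacency_relation':
  "nbr_sum (\<lambda>\<xi>. nbr_sum (\<lambda>\<eta>. \<phi> (d y \<eta>) * f \<eta>) \<xi>) x - qsum 2 * nbr_sum (\<lambda>\<xi>. \<phi> (d y \<xi>) * nbr_sum f \<xi>) x
    + \<phi> (d y x) * nbr_sum (\<lambda>\<xi>. nbr_sum f \<xi>) x = - (\<phi> (d y x) * f x)"
  using adjacency_relation[of y f x] by (simp only: d_commute[of y])

lemma q_serre_maps:
  "q_serre A\<^sub>1 P\<^sub>3" "q_serre P\<^sub>3 A\<^sub>1" "q_serre P\<^sub>3 A\<^sub>2" "q_serre A\<^sub>2 P\<^sub>3" "q_serre A\<^sub>2 P\<^sub>1" "q_serre P\<^sub>1 A\<^sub>2"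
  "q_serre P\<^sub>1 A\<^sub>3" "q_serre A\<^sub>3 P\<^sub>1" "q_serre A\<^sub>1 P\<^sub>2"
  by (simp_all add: q_serre_def vec_eq_iff split_paired_all diagonal_relation diagonal_relation'
      adjacency_relation adjacency_relation')

lemma nbr_sum_swap: "nbr_sum (\<lambda>\<xi>. nbr_sum (\<lambda>\<eta>. f \<xi> \<eta>) y) x = nbr_sum (\<lambda>\<eta>. nbr_sum (\<lambda>\<xi>. f \<xi> \<eta>) x) y"
proof -
  have "nbr_sum (\<lambda>\<xi>. nbr_sum (\<lambda>\<eta>. f \<xi> \<eta>) y) x = (\<kappa> / h) * (\<kappa> / h) * (\<Sum>\<xi>\<in>{\<xi>. d x \<xi> = 1}. \<Sum>\<eta>\<in>{\<eta>. d y \<eta> = 1}. f \<xi> \<eta>)"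
    by (simp add: nbr_sum_def sum_distrib_left mult.assoc)
  also have "\<dots> = nbr_sum (\<lambda>\<eta>. nbr_sum (\<lambda>\<xi>. f \<xi> \<eta>) x) y"
    by (subst sum.swap) (simp add: nbr_sum_def sum_distrib_left mult.assoc)
  finally show ?thesis .
qed

lemma commuting_maps:
  "A\<^sub>1 (A\<^sub>2 v) = A\<^sub>2 (A\<^sub>1 v)" "A\<^sub>1 (A\<^sub>3 v) = A\<^sub>3 (A\<^sub>1 v)" "A\<^sub>2 (A\<^sub>3 v) = A\<^sub>3 (A\<^sub>2 v)"
  "A\<^sub>1 (P\<^sub>1 v) = P\<^sub>1 (A\<^sub>1 v)" "A\<^sub>3 (P\<^sub>3 v) = P\<^sub>3 (A\<^sub>3 v)" "P\<^sub>3 (P\<^sub>1 v) = P\<^sub>1 (P\<^sub>3 v)" "P\<^sub>3 (P\<^sub>2 v) = P\<^sub>2 (P\<^sub>3 v)"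
  by (simp_all add: vec_eq_iff split_paired_all nbr_sum_mult mult.left_commute)
    (intro allI nbr_sum_swap)+

lemma bracket_P\<^sub>3: "op_bracket q P\<^sub>3 (op_bracket q (op_bracket q P\<^sub>2 A\<^sub>1) P\<^sub>3) v = op_bracket q P\<^sub>2 A\<^sub>1 v"
  by (rule op_bracket_bracket_commuting)
    (use q_serre_maps in \<open>simp_all add: linear_maps commuting_maps q_serre_def\<close>)

lemma bracket_A\<^sub>1: "op_bracket q A\<^sub>1 (op_bracket q P\<^sub>2 A\<^sub>1) v = P\<^sub>2 v"
proof -
  have "A\<^sub>1 (A\<^sub>1 (P\<^sub>2 v)) - qsum 2 *s A\<^sub>1 (P\<^sub>2 (A\<^sub>1 v)) + P\<^sub>2 (A\<^sub>1 (A\<^sub>1 v)) = - P\<^sub>2 v"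
    using q_serre_maps(9) by (simp add: q_serre_def)
  then have "P\<^sub>2 v = - (A\<^sub>1 (A\<^sub>1 (P\<^sub>2 v)) - qsum 2 *s A\<^sub>1 (P\<^sub>2 (A\<^sub>1 v)) + P\<^sub>2 (A\<^sub>1 (A\<^sub>1 v)))"
    by simp
  then show ?thesis
    unfolding op_bracket_bracket[OF linear_maps(1,5)] by (simp add: algebra_simps)
qed

text \<open>
  The coordinates of \<open>v\<close> depend on the profile only, via \<open>F\<close>.  The function \<open>F\<close> takes integers because
  \<open>L1\<close>, \<open>L2\<close> and \<open>L3\<close> also evaluate it, with coefficient zero, at points with a negative entry.
\<close>

definition coords :: "complex ^ ('a \<times> 'a \<times> 'a) \<Rightarrow> profile_function \<Rightarrow> bool" where
  "coords v F \<longleftrightarrow> (\<forall>x y z r s t u. profile x y z r s t u \<longrightarrow> v $ (x, y, z) = F r s t u)"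

lemma coordsD: "coords v F \<Longrightarrow> profile x y z r s t u \<Longrightarrow> v $ (x, y, z) = F r s t u"
  by (simp add: coords_def)

lemma nbr_sum_profile:
  assumes "profile x y z r s t u" and "\<And>\<xi> r s t u. profile \<xi> y z r s t u \<Longrightarrow> G \<xi> = F r s t u"
  shows "nbr_sum G x = \<kappa> * L1 F r s t u"
proof -
  have "(\<Sum>\<xi>\<in>{\<xi>. d x \<xi> = 1}. G \<xi>) = h * L1 F r s t u"
    by (rule sum_neighbours) (use assms in auto)
  then show ?thesis using h_nonzero by (simp add: nbr_sum_def)
qed

lemma coords_A1: "coords v F \<Longrightarrow> coords (A\<^sub>1 v) (\<lambda>r s t u. \<kappa> * L1 F r s t u)"
  by (auto simp: coords_def intro!: nbr_sum_profile)

lemma coords_A2: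
  assumes "coords v F"
  shows "coords (A\<^sub>2 v) (\<lambda>r s t u. \<kappa> * L2 F r s t u)"
  unfolding coords_def
proof (intro allI impI)
  fix x y z r s t u assume p: "profile x y z r s t u"
  have "nbr_sum (\<lambda>\<eta>. v $ (x, \<eta>, z)) y = \<kappa> * L1 (\<lambda>r t s u. F r s t u) r t s u"
  proof (rule nbr_sum_profile)
    show "profile y x z r t s u" using p profile_swap12 by blast
    show "v $ (x, \<eta>, z) = F r s t u" if "profile \<eta> x z r t s u" for \<eta> r s t u
      using coordsD[OF assms] that profile_swap12 by blast
  qed
  then show "A\<^sub>2 v $ (x, y, z) = \<kappa> * L2 F r s t u" by (simp add: L1_def L2_def)
qed

lemma coords_A3:
  assumes "coords v F"
  shows "coords (A\<^sub>3 v) (\<lambda>r s t u. \<kappa> * L3 F r s t u)"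
  unfolding coords_def
proof (intro allI impI)
  fix x y z r s t u assume p: "profile x y z r s t u"
  have "nbr_sum (\<lambda>\<zeta>. v $ (x, y, \<zeta>)) z = \<kappa> * L1 (\<lambda>r u t s. F r s t u) r u t s"
  proof (rule nbr_sum_profile)
    show "profile z y x r u t s" using p profile_swap13 by blast
    show "v $ (x, y, \<zeta>) = F r s t u" if "profile \<zeta> y x r u t s" for \<zeta> r s t u
      using coordsD[OF assms] that profile_swap13 by blast
  qed
  then show "A\<^sub>3 v $ (x, y, z) = \<kappa> * L3 F r s t u" by (simp add: L1_def L3_def rate_commute[of r u t s] rate_commute[of u r t s])
qed

lemma \<phi>_profile:
  assumes "profile x y z r s t u"
  shows "\<phi> (d x y) = - \<kappa> * qdiff (r + u - s - t)" "\<phi> (d y z) = - \<kappa> * qdiff (r + s - t - u)"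
    "\<phi> (d z x) = - \<kappa> * qdiff (r + t - s - u)"
proof -
  have D: "int D = r + s + t + u" using assms by (simp add: profile_def)
  show "\<phi> (d x y) = - \<kappa> * qdiff (r + u - s - t)" "\<phi> (d y z) = - \<kappa> * qdiff (r + s - t - u)"
    "\<phi> (d z x) = - \<kappa> * qdiff (r + t - s - u)"
    using assms by (simp_all add: profile_def \<phi>_def D algebra_simps)
qed

lemma coords_P1: "coords v F \<Longrightarrow> coords (P\<^sub>1 v) (\<lambda>r s t u. - \<kappa> * qdiff (r + s - t - u) * F r s t u)"
  and coords_P2: "coords v F \<Longrightarrow> coords (P\<^sub>2 v) (\<lambda>r s t u. - \<kappa> * qdiff (r + t - s - u) * F r s t u)"
  and coords_P3: "coords v F \<Longrightarrow> coords (P\<^sub>3 v) (\<lambda>r s t u. - \<kappa> * qdiff (r + u - s - t) * F r s t u)"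
  by (simp_all add: coords_def \<phi>_profile)

lemma coords_add: "coords v F \<Longrightarrow> coords v' G \<Longrightarrow> coords (v + v') (\<lambda>r s t u. F r s t u + G r s t u)"
  and coords_diff: "coords v F \<Longrightarrow> coords v' G \<Longrightarrow> coords (v - v') (\<lambda>r s t u. F r s t u - G r s t u)"
  and coords_scale: "coords v F \<Longrightarrow> coords (c *s v) (\<lambda>r s t u. c * F r s t u)"
  by (simp_all add: coords_def)

lemma coords_unique: "coords v F \<Longrightarrow> coords v' F \<Longrightarrow> v = v'"
proof -
  assume v: "coords v F" "coords v' F"
  have "v $ (x, y, z) = v' $ (x, y, z)" for x y z
    using profile_exists[of x y z] coordsD[OF v(1)] coordsD[OF v(2)] by metis
  then show ?thesis by (simp add: vec_eq_iff split_paired_all)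
qed

lemma L_scale: "L1 (\<lambda>r s t u. c * F r s t u) = (\<lambda>r s t u. c * L1 F r s t u)"
  "L2 (\<lambda>r s t u. c * F r s t u) = (\<lambda>r s t u. c * L2 F r s t u)"
  "L3 (\<lambda>r s t u. c * F r s t u) = (\<lambda>r s t u. c * L3 F r s t u)"
  "bracket_L3 (\<lambda>r s t u. c * F r s t u) = (\<lambda>r s t u. c * bracket_L3 F r s t u)"
  by (simp_all add: fun_eq_iff L1_def L2_def L3_def bracket_L3_def algebra_simps)

text \<open>
  Both sides are computed on functions of the profile.  The left side moves \<open>y\<close> and \<open>z\<close>, the right side
  moves \<open>x\<close>, and by \<open>hexagon\<close> and \<open>bracket_bracket_L1\<close> both are multiples of \<open>hexagon_side\<close>.
\<close>

lemma hexagon_maps: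
  assumes F: "coords v F"
  shows "op_bracket q A\<^sub>2 (op_bracket q P\<^sub>1 A\<^sub>3) v = - op_bracket q (op_bracket q P\<^sub>2 A\<^sub>1) P\<^sub>3 v"
proof -
  have q1: "q powi 1 = q" "q powi (-1) = inverse q" by simp_all
  let ?c = "- (\<kappa> * \<kappa>) * bracket_unit" and ?K = "q powi 3 - q powi (-1)"
  have 1: "coords (op_bracket q P\<^sub>1 A\<^sub>3 u) (\<lambda>r s t u. ?c * bracket_L3 G r s t u)" if G: "coords u G" for u G
  proof -
    have "(\<lambda>r s t u. q * (- \<kappa> * qdiff (r + s - t - u) * (\<kappa> * L3 G r s t u))
       - inverse q * (\<kappa> * L3 (\<lambda>r s t u. - \<kappa> * qdiff (r + s - t - u) * G r s t u) r s t u))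
       = (\<lambda>r s t u. ?c * bracket_L3 G r s t u)"
    proof (intro ext)
      fix r s t u
      have "q * (- \<kappa> * qdiff (r + s - t - u) * (\<kappa> * L3 G r s t u))
        - inverse q * (\<kappa> * L3 (\<lambda>r s t u. - \<kappa> * qdiff (r + s - t - u) * G r s t u) r s t u)
        = - (\<kappa> * \<kappa>) * (q powi 1 * (qdiff (r + s - t - u) * L3 G r s t u)
        - q powi (- 1) * L3 (\<lambda>r s t u. qdiff (r + s - t - u) * G r s t u) r s t u)"
        unfolding mult.assoc L_scale q1 by (simp add: algebra_simps)
      then show "q * (- \<kappa> * qdiff (r + s - t - u) * (\<kappa> * L3 G r s t u))
        - inverse q * (\<kappa> * L3 (\<lambda>r s t u. - \<kappa> * qdiff (r + s - t - u) * G r s t u) r s t u) = ?c * bracket_L3 G r s t u"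
        unfolding bracket_L3_eq by (simp only: mult.assoc)
    qed
    then show ?thesis
      unfolding op_bracket_def
      using coords_diff[OF coords_scale[OF coords_P1[OF coords_A3[OF G]], of q]
          coords_scale[OF coords_A3[OF coords_P1[OF G]], of "inverse q"]] by (simp only:)
  qed
  have left: "coords (op_bracket q A\<^sub>2 (op_bracket q P\<^sub>1 A\<^sub>3) v) (\<lambda>r s t u. \<kappa> * ?c * ?K * hexagon_side F r s t u)"
  proof -
    have "(\<lambda>r s t u. q * (\<kappa> * L2 (\<lambda>r s t u. ?c * bracket_L3 F r s t u) r s t u) - inverse q * (?c * bracket_L3 (\<lambda>r s t u. \<kappa> * L2 F r s t u) r s t u))
       = (\<lambda>r s t u. \<kappa> * ?c * ?K * hexagon_side F r s t u)"
    proof (intro ext)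
      fix r s t u
      have "q * (\<kappa> * L2 (\<lambda>r s t u. ?c * bracket_L3 F r s t u) r s t u) - inverse q * (?c * bracket_L3 (\<lambda>r s t u. \<kappa> * L2 F r s t u) r s t u)
          = \<kappa> * ?c * (q powi 1 * L2 (bracket_L3 F) r s t u - q powi (- 1) * bracket_L3 (L2 F) r s t u)"
        unfolding L_scale q1 by (simp add: algebra_simps)
      then show "q * (\<kappa> * L2 (\<lambda>r s t u. ?c * bracket_L3 F r s t u) r s t u) - inverse q * (?c * bracket_L3 (\<lambda>r s t u. \<kappa> * L2 F r s t u) r s t u)
         = \<kappa> * ?c * ?K * hexagon_side F r s t u"
        unfolding hexagon by (simp only: mult.assoc)
    qed
    then show ?thesis
      unfolding op_bracket_def[of q "A\<^sub>2"]
      using coords_diff[OF coords_scale[OF coords_A2[OF 1[OF F]], of q]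
          coords_scale[OF 1[OF coords_A2[OF F]], of "inverse q"]] by (simp only:)
  qed
  have right: "coords (op_bracket q (op_bracket q P\<^sub>2 A\<^sub>1) P\<^sub>3 v) (\<lambda>r s t u. - (\<kappa> * ?c * ?K * hexagon_side F r s t u))"
  proof -
    let ?S = "\<lambda>G r s t u. q * (- \<kappa> * qdiff (r + t - s - u) * (\<kappa> * L1 G r s t u))
        - inverse q * (\<kappa> * L1 (\<lambda>r s t u. - \<kappa> * qdiff (r + t - s - u) * G r s t u) r s t u)"
    have S: "coords (op_bracket q P\<^sub>2 A\<^sub>1 u) (?S G)" if G: "coords u G" for u G
      unfolding op_bracket_def
      using coords_diff[OF coords_scale[OF coords_P2[OF coords_A1[OF G]], of q]
          coords_scale[OF coords_A1[OF coords_P2[OF G]], of "inverse q"]] .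
    have "(\<lambda>r s t u. q * ?S (\<lambda>r s t u. - \<kappa> * qdiff (r + u - s - t) * F r s t u) r s t u
          - inverse q * (- \<kappa> * qdiff (r + u - s - t) * ?S F r s t u))
       = (\<lambda>r s t u. - (\<kappa> * ?c * ?K * hexagon_side F r s t u))"
    proof (intro ext)
      fix r s t u
      have "q * ?S (\<lambda>r s t u. - \<kappa> * qdiff (r + u - s - t) * F r s t u) r s t u
          - inverse q * (- \<kappa> * qdiff (r + u - s - t) * ?S F r s t u)
        = \<kappa> * \<kappa> * \<kappa> * (q powi 1 * (q powi 1 * (qdiff (r + t - s - u) * L1 (\<lambda>r s t u. qdiff (r + u - s - t) * F r s t u) r s t u)
              - q powi (- 1) * L1 (\<lambda>r s t u. qdiff (r + t - s - u) * (qdiff (r + u - s - t) * F r s t u)) r s t u)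
            - q powi (- 1) * (qdiff (r + u - s - t) *
              (q powi 1 * (qdiff (r + t - s - u) * L1 F r s t u)
              - q powi (- 1) * L1 (\<lambda>r s t u. qdiff (r + t - s - u) * F r s t u) r s t u)))"
        unfolding L1_def q1 by (simp add: algebra_simps)
      then show "q * ?S (\<lambda>r s t u. - \<kappa> * qdiff (r + u - s - t) * F r s t u) r s t u
          - inverse q * (- \<kappa> * qdiff (r + u - s - t) * ?S F r s t u) = - (\<kappa> * ?c * ?K * hexagon_side F r s t u)"
        unfolding bracket_bracket_L1 by simp
    qed
    then show ?thesis
      unfolding op_bracket_def[of q "op_bracket q P\<^sub>2 A\<^sub>1"]
      using coords_diff[OF coords_scale[OF S[OF coords_P3[OF F]], of q]
          coords_scale[OF coords_P3[OF S[OF F]], of "inverse q"]] by (simp only:)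
  qed
  show ?thesis
    using coords_unique[OF left, of "- op_bracket q (op_bracket q P\<^sub>2 A\<^sub>1) P\<^sub>3 v"] right
    by (simp add: coords_def)
qed

text \<open>
  After \<open>hexagon_maps\<close> has replaced the two inner brackets, \<open>bracket_P\<^sub>3\<close> and \<open>bracket_A\<^sub>1\<close> undo the
  remaining ones.  The replacement is only valid on functions of the profile, so it must be applied
  both to \<open>v\<close> and to the images of \<open>v\<close> under \<open>P\<^sub>3\<close> and \<open>A\<^sub>1\<close>.
\<close>

lemma iterated_bracket_eq_P\<^sub>2:
  assumes F: "coords v F"
  shows "- op_bracket q A\<^sub>1 (op_bracket q P\<^sub>3 (op_bracket q A\<^sub>2 (op_bracket q P\<^sub>1 A\<^sub>3))) v = P\<^sub>2 v"
proof -
  define X where "X = op_bracket q A\<^sub>2 (op_bracket q P\<^sub>1 A\<^sub>3)"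
  define Y where "Y = op_bracket q P\<^sub>2 A\<^sub>1"
  have X: "X u = - op_bracket q Y P\<^sub>3 u" if "coords u G" for u G
    unfolding X_def Y_def using that by (rule hexagon_maps)
  have PX: "op_bracket q P\<^sub>3 X u = - Y u" if G: "coords u G" for u G
  proof -
    have "op_bracket q P\<^sub>3 X u = - op_bracket q P\<^sub>3 (op_bracket q Y P\<^sub>3) u"
      unfolding op_bracket_def[of q P\<^sub>3] X[OF G] X[OF coords_P3[OF G]]
      by (simp add: linear_op_uminus[OF linear_maps(6)])
    then show ?thesis unfolding Y_def bracket_P\<^sub>3 .
  qed
  have "op_bracket q A\<^sub>1 (op_bracket q P\<^sub>3 X) v = - op_bracket q A\<^sub>1 Y v"
    unfolding op_bracket_def[of q A\<^sub>1] PX[OF F] PX[OF coords_A1[OF F]]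
    by (simp add: linear_op_uminus[OF linear_maps(1)])
  then show ?thesis
    unfolding X_def[symmetric] by (simp add: Y_def bracket_A\<^sub>1)
qed

end

section \<open>Modules over a quotient of a free algebra\<close>

text \<open>
  The action of the free algebra in which the generator \<open>g\<close> acts as \<open>T g\<close>: a word acts by composition,
  an arbitrary element by linear extension.
\<close>

definition word_op :: "('g \<Rightarrow> complex ^ 'n \<Rightarrow> complex ^ 'n) \<Rightarrow> 'g free_monoid \<Rightarrow> complex ^ 'n \<Rightarrow> complex ^ 'n" where
  "word_op T w v = foldr T (letters w) v"

definition rep :: "('g \<Rightarrow> complex ^ 'n \<Rightarrow> complex ^ 'n) \<Rightarrow> 'g free_algebra \<Rightarrow> complex ^ 'n \<Rightarrow> complex ^ 'n" where
  "rep T f v = (\<Sum>w\<in>Poly_Mapping.keys f. Poly_Mapping.lookup f w *s word_op T w v)"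

lemma sum_keys_single:
  "(\<Sum>w\<in>Poly_Mapping.keys f. Poly_Mapping.single w (Poly_Mapping.lookup f w)) = f"
  by (rule poly_mapping_eqI) (simp add: lookup_sum lookup_single when_def in_keys_iff)

locale linear_family =
  fixes T :: "'g \<Rightarrow> complex ^ 'n \<Rightarrow> complex ^ 'n"
  assumes T_add: "T g (v + w) = T g v + T g w" and T_scale: "T g (c *s v) = c *s T g v"
begin

lemma word_op_add: "word_op T w (u + v) = word_op T w u + word_op T w v"
proof -
  have "foldr T gs (u + v) = foldr T gs u + foldr T gs v" for gs
    by (induction gs) (simp_all add: T_add)
  then show ?thesis by (simp add: word_op_def)
qed

lemma word_op_scale: "word_op T w (c *s v) = c *s word_op T w v"
proof -
  have "foldr T gs (c *s v) = c *s foldr T gs v" for gs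
    by (induction gs) (simp_all add: T_scale)
  then show ?thesis by (simp add: word_op_def)
qed

lemma word_op_plus: "word_op T (w + w') v = word_op T w (word_op T w' v)"
  by (simp add: word_op_def plus_free_monoid_def)

lemma rep_superset:
  assumes "finite S" "Poly_Mapping.keys f \<subseteq> S"
  shows "rep T f v = (\<Sum>w\<in>S. Poly_Mapping.lookup f w *s word_op T w v)"
  unfolding rep_def
  by (rule sum.mono_neutral_left) (use assms in \<open>auto simp: in_keys_iff\<close>)

lemma rep_add: "rep T (f + g) v = rep T f v + rep T g v"
proof -
  let ?S = "Poly_Mapping.keys f \<union> Poly_Mapping.keys g"
  have "Poly_Mapping.keys (f + g) \<subseteq> ?S" by (rule Poly_Mapping.keys_add)
  then show ?thesis
    by (simp add: rep_superset[of ?S] lookup_add vec.scale_left_distrib sum.distrib)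
qed

lemma rep_single: "rep T (Poly_Mapping.single w c) v = c *s word_op T w v"
  by (cases "c = 0") (simp_all add: rep_def)

lemma rep_zero: "rep T 0 v = 0" by (simp add: rep_def)

lemma rep_sum: "rep T (sum h S) v = (\<Sum>i\<in>S. rep T (h i) v)"
  by (induction S rule: infinite_finite_induct) (simp_all add: rep_zero rep_add)

lemma rep_add_right: "rep T f (u + v) = rep T f u + rep T f v"
  by (simp add: rep_def word_op_add vec.scale_right_distrib sum.distrib)

lemma rep_scale_right: "rep T f (c *s v) = c *s rep T f v"
  by (simp add: rep_def word_op_scale vec.scale_sum_right mult.commute)

lemma rep_sum_right: "rep T f (sum h S) = (\<Sum>i\<in>S. rep T f (h i))"
proof -
  have "rep T f 0 = 0" using rep_scale_right[of f 0 0] by simp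
  then show ?thesis
    by (induction S rule: infinite_finite_induct) (simp_all add: rep_add_right)
qed

lemma rep_mult: "rep T (f * g) v = rep T f (rep T g v)"
proof -
  have "f * g = (\<Sum>w\<in>Poly_Mapping.keys f. Poly_Mapping.single w (Poly_Mapping.lookup f w)) *
      (\<Sum>w\<in>Poly_Mapping.keys g. Poly_Mapping.single w (Poly_Mapping.lookup g w))"
    by (simp only: sum_keys_single)
  also have "rep T \<dots> v = (\<Sum>w\<in>Poly_Mapping.keys f. \<Sum>w'\<in>Poly_Mapping.keys g.
      Poly_Mapping.lookup f w *s word_op T w (Poly_Mapping.lookup g w' *s word_op T w' v))"
    by (simp add: sum_product rep_sum mult_single rep_single word_op_plus word_op_scale)
  also have "\<dots> = rep T f (rep T g v)"
    unfolding rep_def[of T g] rep_sum_right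
    by (subst sum.swap) (simp add: rep_def)
  finally show ?thesis .
qed

lemma rep_uminus: "rep T (- f) v = - rep T f v"
  using rep_add[of f "- f" v] by (simp add: rep_zero eq_neg_iff_add_eq_0 add.commute)

lemma rep_diff: "rep T (f - g) v = rep T f v - rep T g v"
  using rep_add[of f "- g" v] by (simp add: rep_uminus)

lemma rep_gen: "rep T (free_gen g) v = T g v"
  by (simp add: free_gen_def rep_single word_op_def)

lemma rep_const: "rep T (free_const c) v = c *s v"
  by (simp add: free_const_def rep_single word_op_def zero_free_monoid_def)

lemma rep_one: "rep T 1 v = v"
  using rep_const[of 1 v] by (simp add: free_const_def)

lemma rep_mem_subspace:
  assumes "vec.subspace L" "\<And>g v. v \<in> L \<Longrightarrow> T g v \<in> L" "v \<in> L"
  shows "rep T f v \<in> L"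
proof -
  have "foldr T gs v \<in> L" for gs
    by (induction gs) (use assms in auto)
  then show ?thesis
    unfolding rep_def word_op_def by (intro vec.subspace_sum vec.subspace_scale assms)
qed

lemma ideal_rep_kernel: "ideal {f. \<forall>v. rep T f v = 0} free_ring"
proof (rule idealI)
  show "ring (free_ring :: 'g free_algebra ring)" by (rule ring_free_ring)
  have inv: "m_inv (add_monoid (free_ring :: 'g free_algebra ring)) f = - f" for f
  proof -
    interpret ring "free_ring :: 'g free_algebra ring" by (rule ring_free_ring)
    have "\<ominus>\<^bsub>free_ring\<^esub> f = - f"
      by (rule minus_equality) (simp_all add: free_ring_def)
    then show ?thesis by (simp add: a_inv_def)
  qed
  show "subgroup {f. \<forall>v. rep T f v = 0} (add_monoid (free_ring :: 'g free_algebra ring))"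
    by (rule subgroup.intro)
      (use inv in \<open>simp_all add: free_ring_def rep_add rep_zero rep_uminus\<close>)
qed (auto simp: free_ring_def rep_mult rep_zero, metis rep_scale_right vec.scale_zero_left)

end

lemma ideal_so6_ideal: "ideal (so6_ideal q) free_ring"
  unfolding so6_ideal_def by (intro ring.genideal_ideal ring_free_ring) (simp add: free_ring_def)

lemma Uso6_class_altdef: "Uso6_class q f = {i + f |i. i \<in> so6_ideal q}"
  by (auto simp: Uso6_class_def a_r_coset_def' free_ring_def)

lemma mem_Uso6_class_self: "f \<in> Uso6_class q f"
proof -
  have "0 \<in> so6_ideal q"
    using additive_subgroup.zero_closed[OF ideal.axioms(1)[OF ideal_so6_ideal[of q]]] by (simp add: free_ring_def)
  then show ?thesis unfolding Uso6_class_altdef by force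
qed

lemma Uso6_class_hom: "ring_hom_ring free_ring (Uso6 q) (Uso6_class q)"
  using ideal.rcos_ring_hom_ring[OF ideal_so6_ideal] by (simp add: Uso6_def Uso6_class_def[abs_def])

lemma Uso6_class_simps:
  "Uso6_class q f \<oplus>\<^bsub>Uso6 q\<^esub> Uso6_class q g = Uso6_class q (f + g)"
  "Uso6_class q f \<otimes>\<^bsub>Uso6 q\<^esub> Uso6_class q g = Uso6_class q (f * g)"
  "\<one>\<^bsub>Uso6 q\<^esub> = Uso6_class q 1"
  "\<ominus>\<^bsub>Uso6 q\<^esub> Uso6_class q f = Uso6_class q (- f)"
  "Uso6_class q f \<ominus>\<^bsub>Uso6 q\<^esub> Uso6_class q g = Uso6_class q (f - g)"
  "Uso6_scale q c (Uso6_class q f) = Uso6_class q (free_const c * f)"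
proof -
  interpret ring_hom_ring "free_ring :: so6_gen free_algebra ring" "Uso6 q" "Uso6_class q"
    by (rule Uso6_class_hom)
  have carr: "f \<in> carrier free_ring" for f :: "so6_gen free_algebra" by (simp add: free_ring_def)
  show add: "Uso6_class q f \<oplus>\<^bsub>Uso6 q\<^esub> Uso6_class q g = Uso6_class q (f + g)" for f g
    using hom_add[OF carr carr, of f g] by (simp add: free_ring_def)
  show mult: "Uso6_class q f \<otimes>\<^bsub>Uso6 q\<^esub> Uso6_class q g = Uso6_class q (f * g)" for f g
    using hom_mult[OF carr carr, of f g] by (simp add: free_ring_def)
  show "\<one>\<^bsub>Uso6 q\<^esub> = Uso6_class q 1"
    using hom_one by (simp add: free_ring_def)
  have "\<ominus>\<^bsub>free_ring\<^esub> f = - f" for f :: "so6_gen free_algebra"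
    by (rule R.minus_equality) (simp_all add: free_ring_def)
  then show neg: "\<ominus>\<^bsub>Uso6 q\<^esub> Uso6_class q f = Uso6_class q (- f)" for f
    using hom_a_inv[OF carr, of f] by simp
  show "Uso6_class q f \<ominus>\<^bsub>Uso6 q\<^esub> Uso6_class q g = Uso6_class q (f - g)"
    unfolding a_minus_def neg add by simp
  show "Uso6_scale q c (Uso6_class q f) = Uso6_class q (free_const c * f)"
    unfolding Uso6_scale_def mult ..
qed

lemma carrier_Uso6: "carrier (Uso6 q) = range (Uso6_class q)"
  by (auto simp: Uso6_def FactRing_def A_RCOSETS_def' free_ring_def Uso6_class_def)

locale so6_representation = linear_family T
  for T :: "so6_gen \<Rightarrow> complex ^ 'n \<Rightarrow> complex ^ 'n" +
  fixes q :: complex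
  assumes adjacent: "\<bar>gen_index i - gen_index j\<bar> = 1 \<Longrightarrow>
      T i (T i (T j v)) - (q powi 2 + q powi (- 2)) *s T i (T j (T i v)) + T j (T i (T i v)) + T j v = 0"
    and distant: "\<bar>gen_index i - gen_index j\<bar> \<ge> 2 \<Longrightarrow> T i (T j v) = T j (T i v)"
begin

text \<open>
  The elements that act as zero form an ideal, which contains the relators.
\<close>

lemma rep_so6_ideal:
  assumes "f \<in> so6_ideal q"
  shows "rep T f v = 0"
proof -
  have expand: "rep T (free_gen i * free_gen i * free_gen j - free_const c * (free_gen i * free_gen j * free_gen i)
        + free_gen j * free_gen i * free_gen i + free_gen j) v
      = T i (T i (T j v)) - c *s T i (T j (T i v)) + T j (T i (T i v)) + T j v" for i j c v
    by (simp add: rep_add rep_diff rep_mult rep_gen rep_const)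
  have "rep T f v = 0" if "f \<in> so6_relators q" for f v
    using that unfolding so6_relators_def
    by (auto simp only: expand adjacent distant rep_diff rep_mult rep_gen diff_self)
  then have "so6_relators q \<subseteq> {f. \<forall>v. rep T f v = 0}"
    by blast
  then have "so6_ideal q \<subseteq> {f. \<forall>v. rep T f v = 0}"
    unfolding so6_ideal_def by (intro ring.genideal_minimal ring_free_ring ideal_rep_kernel)
  then show ?thesis using assms by blast
qed

text \<open>
  A coset acts like any of its elements; \<open>act_class\<close> shows that the choice does not matter, because the
  ideal acts as zero.
\<close>

definition act :: "so6_gen free_algebra set \<Rightarrow> complex ^ 'n \<Rightarrow> complex ^ 'n" where
  "act a v = rep T (SOME f. f \<in> a) v"

lemma act_class: "act (Uso6_class q f) v = rep T f v"
proof -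
  have "(SOME g. g \<in> Uso6_class q f) \<in> Uso6_class q f"
    by (rule someI) (rule mem_Uso6_class_self)
  then show ?thesis
    unfolding act_def by (auto simp: Uso6_class_altdef rep_add rep_so6_ideal)
qed

lemma act_Bgen: "act (Bgen q g) v = T g v"
  by (simp add: Bgen_def act_class rep_gen)

lemma algebra_module_act:
  assumes "vec.subspace L" "\<And>g v. v \<in> L \<Longrightarrow> T g v \<in> L"
  shows "algebra_module (Uso6 q) (Uso6_scale q) L act"
  using assms rep_mem_subspace[OF assms]
  by (auto simp: algebra_module_def carrier_Uso6 Uso6_class_simps act_class rep_add_right rep_scale_right
      rep_add rep_mult rep_const rep_one)

definition free_bracket :: "so6_gen free_algebra \<Rightarrow> so6_gen free_algebra \<Rightarrow> so6_gen free_algebra" where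
  "free_bracket f g = free_const q * (f * g) - free_const (inverse q) * (g * f)"

lemma q_bracket_class: "q_bracket q (Uso6_class q f) (Uso6_class q g) = Uso6_class q (free_bracket f g)"
  by (simp add: q_bracket_def Uso6_class_simps free_bracket_def)

lemma rep_free_bracket: "rep T (free_bracket f g) = op_bracket q (rep T f) (rep T g)"
  by (simp add: fun_eq_iff free_bracket_def op_bracket_def rep_diff rep_mult rep_const)

lemma act_B6: "act (B6 q) v =
    - op_bracket q (T G1) (op_bracket q (T G2) (op_bracket q (T G3) (op_bracket q (T G4) (T G5)))) v"
proof -
  have gen: "rep T (free_gen g) = T g" for g by (simp add: fun_eq_iff rep_gen)
  show ?thesis
    unfolding B6_def Bgen_def q_bracket_class Uso6_class_simps act_class rep_uminus rep_free_bracket gen ..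
qed

end

section \<open>The space \<open>\<Lambda>\<close> as a module\<close>

lemma tensor_map_nth:
  fixes v :: "complex ^ ('a::finite \<times> 'a \<times> 'a)"
  shows
  "tensor_map f v $ p = (\<Sum>k\<in>UNIV. v $ k * (case k of (x, y, z) \<Rightarrow> f x y z $ p))"
  unfolding tensor_map_def sum_component by (intro sum.cong) (auto split: prod.splits)

lemma diagonal_tensor_map_nth:
  fixes v :: "complex ^ ('a::finite \<times> 'a \<times> 'a)"
  shows
  "tensor_map (\<lambda>x y z. c x y z *s basis_tensor x y z) v $ (x, y, z) = c x y z * v $ (x, y, z)"
proof -
  have "tensor_map (\<lambda>x y z. c x y z *s basis_tensor x y z) v $ (x, y, z)
      = (\<Sum>k\<in>UNIV. if k = (x, y, z) then c x y z * v $ (x, y, z) else 0)"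
    unfolding tensor_map_nth by (intro sum.cong) (auto simp: basis_tensor_eq_axis axis_def split: if_splits)
  then show ?thesis by simp
qed

text \<open>
  The coordinate at \<open>k\<close> collects the coordinates of \<open>v\<close> at the triples that are sent to a sum containing
  \<open>k\<close>.  All three adjacency maps have this form.
\<close>

lemma incidence_tensor_map_nth:
  fixes v :: "complex ^ ('a::finite \<times> 'a \<times> 'a)"
  shows
  "tensor_map (\<lambda>x y z. \<Sum>p\<in>S x y z. axis p 1) v $ k = (\<Sum>p\<in>{(x, y, z). k \<in> S x y z}. v $ p)"
proof -
  have "tensor_map (\<lambda>x y z. \<Sum>p\<in>S x y z. axis p 1) v $ k
      = (\<Sum>p\<in>UNIV. if p \<in> {(x, y, z). k \<in> S x y z} then v $ p else 0)"
    unfolding tensor_map_nth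
  proof (intro sum.cong refl)
    fix p :: "'a \<times> 'a \<times> 'a"
    obtain x y z where p: "p = (x, y, z)" by (cases p)
    have "(\<Sum>p\<in>S x y z. axis p 1) $ k = (\<Sum>p\<in>S x y z. if p = k then 1 else (0 :: complex))"
      unfolding sum_component by (intro sum.cong) (auto simp: axis_def)
    then show "v $ p * (case p of (x, y, z) \<Rightarrow> (\<Sum>p\<in>S x y z. axis p 1) $ k)
        = (if p \<in> {(x, y, z). k \<in> S x y z} then v $ p else 0)"
      by (simp add: p)
  qed
  then show ?thesis by (simp add: sum.If_cases)
qed

context two_homogeneous
begin

primrec so6_map :: "so6_gen \<Rightarrow> complex ^ ('a \<times> 'a \<times> 'a) \<Rightarrow> complex ^ ('a \<times> 'a \<times> 'a)" where
  "so6_map G1 = A\<^sub>1" | "so6_map G2 = P\<^sub>3" | "so6_map G3 = A\<^sub>2" | "so6_map G4 = P\<^sub>1" | "so6_map G5 = A\<^sub>3"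

lemma so6_representation_so6_map: "so6_representation so6_map q"
proof
  show "so6_map g (v + w) = so6_map g v + so6_map g w" for g v w
    by (cases g) (simp_all add: linear_maps linear_op_add)
  show "so6_map g (c *s v) = c *s so6_map g v" for g c v
    by (cases g) (simp_all add: linear_maps linear_op_scale)
  show "so6_map i (so6_map i (so6_map j v)) - (q powi 2 + q powi (- 2)) *s so6_map i (so6_map j (so6_map i v))
      + so6_map j (so6_map i (so6_map i v)) + so6_map j v = 0"
    if "\<bar>gen_index i - gen_index j\<bar> = 1" for i j v
  proof -
    have "q_serre (so6_map i) (so6_map j)"
      using that q_serre_maps by (cases i; cases j) simp_all
    then show ?thesis by (simp add: q_serre_def qsum_def)
  qed
  show "so6_map i (so6_map j v) = so6_map j (so6_map i v)" if "\<bar>gen_index i - gen_index j\<bar> \<ge> 2" for i j v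
    using that by (cases i; cases j) (simp_all add: commuting_maps)
qed

lemma has_profile_iff:
  assumes "(r, s, t, u) \<in> profiles D"
  shows "has_profile adj (r, s, t, u) x y z \<longleftrightarrow> profile x y z (int r) (int s) (int t) (int u)"
  using assms by (auto simp: has_profile_def profile_def profiles_def d_def)

lemma profile_vector_nth:
  "profile_vector adj p $ (x, y, z) = (if has_profile adj p x y z then 1 else 0)"
proof -
  have "profile_vector adj p $ (x, y, z)
      = (\<Sum>k\<in>{(x, y, z). has_profile adj p x y z}. if k = (x, y, z) then 1 else 0)"
    unfolding profile_vector_def sum_component
    by (intro sum.cong) (auto simp: basis_tensor_eq_axis axis_def split: if_splits)
  then show ?thesis by simp
qed

lemma finite_profiles: "finite (profiles D)"
proof (rule finite_subset)
  show "profiles D \<subseteq> {..D} \<times> {..D} \<times> {..D} \<times> {..D}" by (auto simp: profiles_def)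
qed auto

lemma profile_unique:
  "profile x y z r s t u \<Longrightarrow> profile x y z r' s' t' u' \<Longrightarrow> r = r' \<and> s = s' \<and> t = t' \<and> u = u'"
  by (auto simp: profile_def)

text \<open>
  Since every triple has exactly one profile, and its entries are not negative, the profile vectors are
  the indicator functions of a partition of the set of triples.
\<close>

lemma Lambda_space_iff: "v \<in> Lambda_space adj \<longleftrightarrow> (\<exists>F. coords v F)"
proof
  assume "v \<in> Lambda_space adj"
  then have "v \<in> vec.span (profile_vector adj ` profiles D)" by (simp add: Lambda_space_def D_diam)
  then show "\<exists>F. coords v F"
  proof (induction rule: vec.span_induct)
    case base
    show ?case
    proof (rule vec.subspaceI)
      show "0 \<in> {v. \<exists>F. coords v F}" by (auto simp: coords_def intro!: exI[of _ "\<lambda>r s t u. 0"])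
    qed (use coords_add coords_scale in blast)+
  next
    case (step v)
    then obtain r s t u where v: "(r, s, t, u) \<in> profiles D" "v = profile_vector adj (r, s, t, u)" by auto
    have "coords v (\<lambda>r' s' t' u'. if (r', s', t', u') = (int r, int s, int t, int u) then 1 else 0)"
      unfolding coords_def v(2) profile_vector_nth has_profile_iff[OF v(1)]
      using profile_unique by (auto 0 3)
    then show ?case by blast
  qed
next
  assume "\<exists>F. coords v F"
  then obtain F where F: "coords v F" ..
  have "v = (\<Sum>(r, s, t, u)\<in>profiles D. F (int r) (int s) (int t) (int u) *s profile_vector adj (r, s, t, u))"
  proof -
    have "v $ (x, y, z) = (\<Sum>(r, s, t, u)\<in>profiles D. F (int r) (int s) (int t) (int u) *s profile_vector adj (r, s, t, u)) $ (x, y, z)"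
      for x y z
    proof -
      obtain r s t u where p: "profile x y z r s t u" and r: "r \<ge> 0" using profile_exists by blast
      note nn = profile_nonneg[OF p] r
      let ?p = "(nat r, nat s, nat t, nat u)"
      have mem: "?p \<in> profiles D" using p nn by (auto simp: profiles_def profile_def)
      have "(\<Sum>(r, s, t, u)\<in>profiles D. F (int r) (int s) (int t) (int u) *s profile_vector adj (r, s, t, u)) $ (x, y, z)
          = (\<Sum>k\<in>profiles D. if k = ?p then F r s t u else 0)"
        unfolding sum_component
      proof (rule sum.cong, goal_cases)
        case (2 k)
        obtain r' s' t' u' where k: "k = (r', s', t', u')" by (cases k)
        have "has_profile adj k x y z \<longleftrightarrow> k = ?p"
        proof
          assume "has_profile adj k x y z"
          then have "profile x y z (int r') (int s') (int t') (int u')"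
            using has_profile_iff[of r' s' t' u' x y z] 2 unfolding k by blast
          from profile_unique[OF p this] show "k = ?p" by (simp add: k)
        next
          assume "k = ?p"
          then show "has_profile adj k x y z"
            using has_profile_iff[OF mem, of x y z] p nn by simp
        qed
        then show ?case using nn by (auto simp: k profile_vector_nth)
      qed simp
      also have "\<dots> = F r s t u" using mem finite_profiles by simp
      finally show ?thesis using coordsD[OF F p] by simp
    qed
    then show ?thesis by (simp add: vec_eq_iff split_paired_all)
  qed
  moreover have "(\<Sum>(r, s, t, u)\<in>profiles D. F (int r) (int s) (int t) (int u) *s profile_vector adj (r, s, t, u))
      \<in> vec.span (profile_vector adj ` profiles D)"
    by (rule vec.span_sum) (auto intro: vec.span_scale[OF vec.span_base])
  ultimately show "v \<in> Lambda_space adj" by (simp add: Lambda_space_def D_diam)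
qed

lemma so6_map_Lambda: "v \<in> Lambda_space adj \<Longrightarrow> so6_map g v \<in> Lambda_space adj"
  unfolding Lambda_space_iff
  by (cases g) (simp_all, (blast intro: coords_A1 coords_A2 coords_A3 coords_P1 coords_P3)+)

lemma adjacency_maps_nth:
  "A1 adj v $ (x, y, z) = (\<Sum>\<xi>\<in>{\<xi>. d x \<xi> = 1}. v $ (\<xi>, y, z))"
  "A2 adj v $ (x, y, z) = (\<Sum>\<xi>\<in>{\<xi>. d y \<xi> = 1}. v $ (x, \<xi>, z))"
  "A3 adj v $ (x, y, z) = (\<Sum>\<xi>\<in>{\<xi>. d z \<xi> = 1}. v $ (x, y, \<xi>))"
proof -
  have sum_image: "(\<Sum>\<xi>\<in>S. basis_tensor (f \<xi>) (g \<xi>) (h \<xi>)) = (\<Sum>p\<in>(\<lambda>\<xi>. (f \<xi>, g \<xi>, h \<xi>)) ` S. axis p 1)"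
    if "inj (\<lambda>\<xi>. (f \<xi>, g \<xi>, h \<xi>))" for f g h :: "'a \<Rightarrow> 'a" and S
    using that by (subst sum.reindex) (auto simp: basis_tensor_eq_axis intro: inj_on_subset)
  have sphere: "sphere_at adj (Suc 0) x = {\<xi>. d \<xi> x = 1}" for x
    using d_commute by (auto simp: sphere_at_def d_def)
  have "A1 adj v $ (x, y, z) = (\<Sum>p\<in>(\<lambda>\<xi>. (\<xi>, y, z)) ` {\<xi>. d x \<xi> = 1}. v $ p)"
    unfolding A1_def
    by (subst sum_image) (auto simp: inj_on_def incidence_tensor_map_nth sphere intro!: sum.cong)
  then show "A1 adj v $ (x, y, z) = (\<Sum>\<xi>\<in>{\<xi>. d x \<xi> = 1}. v $ (\<xi>, y, z))"
    by (subst (asm) sum.reindex) (auto simp: inj_on_def)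
  have "A2 adj v $ (x, y, z) = (\<Sum>p\<in>(\<lambda>\<xi>. (x, \<xi>, z)) ` {\<xi>. d y \<xi> = 1}. v $ p)"
    unfolding A2_def
    by (subst sum_image) (auto simp: inj_on_def incidence_tensor_map_nth sphere intro!: sum.cong)
  then show "A2 adj v $ (x, y, z) = (\<Sum>\<xi>\<in>{\<xi>. d y \<xi> = 1}. v $ (x, \<xi>, z))"
    by (subst (asm) sum.reindex) (auto simp: inj_on_def)
  have "A3 adj v $ (x, y, z) = (\<Sum>p\<in>(\<lambda>\<xi>. (x, y, \<xi>)) ` {\<xi>. d z \<xi> = 1}. v $ p)"
    unfolding A3_def
    by (subst sum_image) (auto simp: inj_on_def incidence_tensor_map_nth sphere intro!: sum.cong)
  then show "A3 adj v $ (x, y, z) = (\<Sum>\<xi>\<in>{\<xi>. d z \<xi> = 1}. v $ (x, y, \<xi>))"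
    by (subst (asm) sum.reindex) (auto simp: inj_on_def)
qed

lemma normalized_adjacency_maps:
  "A\<^sub>1 v = (\<kappa> / h) *s A1 adj v" "A\<^sub>2 v = (\<kappa> / h) *s A2 adj v" "A\<^sub>3 v = (\<kappa> / h) *s A3 adj v"
  by (simp_all add: vec_eq_iff split_paired_all adjacency_maps_nth nbr_sum_def)

lemma normalized_dual_maps:
  assumes "\<And>i. i \<le> D \<Longrightarrow> \<theta>s i = \<theta> (int i)"
  shows "P\<^sub>1 v = (- \<kappa> / h) *s A1s adj \<theta>s v" "P\<^sub>2 v = (- \<kappa> / h) *s A2s adj \<theta>s v"
    "P\<^sub>3 v = (- \<kappa> / h) *s A3s adj \<theta>s v"
proof -
  have "\<theta>s (gdist adj x y) = \<theta> (d x y)" for x y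
    using assms[of "gdist adj x y"] gdist_le_diameter[OF conn, of x y] by (simp add: D_diam d_def)
  then show "P\<^sub>1 v = (- \<kappa> / h) *s A1s adj \<theta>s v" "P\<^sub>2 v = (- \<kappa> / h) *s A2s adj \<theta>s v"
    "P\<^sub>3 v = (- \<kappa> / h) *s A3s adj \<theta>s v"
    by (simp_all add: vec_eq_iff split_paired_all A1s_def A2s_def A3s_def diagonal_tensor_map_nth \<phi>_eq)
qed

theorem so6_module:
  assumes "\<And>i. i \<le> D \<Longrightarrow> \<theta>s i = \<theta> (int i)"
  shows "\<exists>act. algebra_module (Uso6 q) (Uso6_scale q) (Lambda_space adj) act \<and>
    (\<forall>v\<in>Lambda_space adj.
       act (Bgen q G1) v = (\<kappa> / h) *s A1 adj v \<and>
       act (Bgen q G3) v = (\<kappa> / h) *s A2 adj v \<and>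
       act (Bgen q G5) v = (\<kappa> / h) *s A3 adj v \<and>
       act (Bgen q G2) v = (- \<kappa> / h) *s A3s adj \<theta>s v \<and>
       act (Bgen q G4) v = (- \<kappa> / h) *s A1s adj \<theta>s v \<and>
       act (B6 q) v = (- \<kappa> / h) *s A2s adj \<theta>s v)"
proof -
  interpret so6_representation so6_map q by (rule so6_representation_so6_map)
  have "algebra_module (Uso6 q) (Uso6_scale q) (Lambda_space adj) act"
    by (rule algebra_module_act) (auto simp: Lambda_space_def so6_map_Lambda[unfolded Lambda_space_def])
  moreover have "act (B6 q) v = P\<^sub>2 v" if "v \<in> Lambda_space adj" for v
    using that unfolding Lambda_space_iff by (auto simp: act_B6 iterated_bracket_eq_P\<^sub>2)
  ultimately show ?thesis
    by (intro exI[of _ act])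
      (simp add: act_Bgen normalized_adjacency_maps normalized_dual_maps[of \<theta>s, OF assms])
qed

end

theorem theorem10p17:
  fixes adj :: "'a::finite \<Rightarrow> 'a \<Rightarrow> bool"
    and E :: "nat \<Rightarrow> complex ^ 'a ^ 'a"
    and \<theta> \<theta>s :: "nat \<Rightarrow> complex"
    and D :: nat
    and q H :: complex
  assumes "D = graph_diameter adj" and "D \<ge> 3"
    and "two_homogeneous_bipartite adj"
    and "\<not> is_hypercube adj" and "\<not> is_cycle_graph adj"
    and "Q_polynomial_ordering adj E"
    and "\<forall>i\<le>D. dist_matrix adj 1 ** E i = mscale (\<theta> i) (E i)"
    and "E 1 = mscale (1 / of_nat CARD('a)) (\<Sum>i\<le>D. mscale (\<theta>s i) (dist_matrix adj i))"
    and "q \<noteq> 0" and "\<forall>n>0. q ^ n \<noteq> 1"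
    and "H = \<i> * (q powi (int D - 2) + q powi (2 - int D)) / (q powi (-2) - q powi 2)"
    and "\<forall>i\<le>D. \<theta> i = H * \<i> * (q powi (int D - 2 * int i) - q powi (2 * int i - int D))"
    and "\<forall>i\<le>D. \<theta>s i = H * \<i> * (q powi (int D - 2 * int i) - q powi (2 * int i - int D))"
    and "\<forall>i\<le>D. of_nat (c_num adj i) =
           H * \<i> * ((q powi (2 * int i) - q powi (- 2 * int i)) /
                    (q powi (int D - 2 * int i) + q powi (2 * int i - int D)))"
    and "\<forall>i\<le>D. of_nat (b_num adj i) =
           H * \<i> * ((q powi (2 * int D - 2 * int i) - q powi (2 * int i - 2 * int D)) /
                    (q powi (int D - 2 * int i) + q powi (2 * int i - int D)))"
  shows "\<exists>act. algebra_module (Uso6 q) (Uso6_scale q) (Lambda_space adj) act \<and>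
    (\<forall>v\<in>Lambda_space adj.
       act (Bgen q G1) v = (1 / (H * (q powi 2 - q powi (-2)))) *s A1 adj v \<and>
       act (Bgen q G3) v = (1 / (H * (q powi 2 - q powi (-2)))) *s A2 adj v \<and>
       act (Bgen q G5) v = (1 / (H * (q powi 2 - q powi (-2)))) *s A3 adj v \<and>
       act (Bgen q G2) v = (1 / (H * (q powi (-2) - q powi 2))) *s A3s adj \<theta>s v \<and>
       act (Bgen q G4) v = (1 / (H * (q powi (-2) - q powi 2))) *s A1s adj \<theta>s v \<and>
       act (B6 q) v = (1 / (H * (q powi (-2) - q powi 2))) *s A2s adj \<theta>s v)"
proof -
  interpret not_root_of_unity q
    using assms(9,10) by unfold_locales auto
  have dr: "distance_regular adj" and a0: "\<forall>i\<le>graph_diameter adj. a_num adj i = 0"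
    using assms(3) by (auto simp: two_homogeneous_bipartite_def)
  have conn: "connected_simple_graph adj" using dr by (simp add: distance_regular_def)
  have diam: "1 \<le> graph_diameter adj" using assms(1,2) by linarith
  have le_D: "gdist adj x y \<le> D" for x y using gdist_le_diameter[OF conn] assms(1) by simp
  define h where "h = H * \<i>"
  have prim: "primitive_idempotents adj E"
    using assms(6) by (simp add: Q_polynomial_ordering_def)
  have real: "cnj (\<theta> i) = \<theta> i" if "i \<le> D" for i
  proof (rule eigenvalue_real[OF conn])
    show "dist_matrix adj 1 ** E i = mscale (\<theta> i) (E i)" using assms(7) that by blast
    have "mat.independent (E ` {..D})" using prim assms(1) by (simp add: primitive_idempotents_def)
    then have "0 \<notin> E ` {..D}" using mat.dependent_zero[of "E ` {..D}"] by argo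
    then show "E i \<noteq> 0" using that by (metis atMost_iff imageI)
  qed
  have idem: "E 1 ** E 1 = E 1"
    using prim diam unfolding primitive_idempotents_def by auto
  have \<theta>: "\<theta> i = h * qdiff (int D - 2 * int i)" "\<theta>s i = h * qdiff (int D - 2 * int i)" if "i \<le> D" for i
    using assms(12,13) that by (simp_all add: h_def qdiff_def)
  have h: "h * qdiff 2 = qsum (int D - 2)"
  proof -
    have "H = - \<i> * qsum (int D - 2) / qdiff 2"
    proof -
      have "q powi (- 2) - q powi 2 = - qdiff 2" unfolding qdiff_def by simp
      moreover have "q powi (int D - 2) + q powi (2 - int D) = qsum (int D - 2)" by (simp add: qsum_def)
      ultimately show ?thesis using assms(11) by (simp only:) simp
    qed
    then show ?thesis by (simp add: h_def qdiff_eq_0_iff mult.commute mult.left_commute)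
  qed
  \<comment> \<open>The matrix E 1 has the entries \<theta>s (gdist adj x y) / CARD('a), and \<theta>s = \<theta> up to index D; so the
    kernel \<theta> of the locale is idempotent up to a factor because E 1 is, and real because \<theta> is.\<close>
  interpret two_homogeneous q adj D h "\<lambda>x y. int (gdist adj x y)" "\<lambda>i. h * qdiff (int D - 2 * i)"
  proof unfold_locales
    fix x \<xi> y
    show "int (gdist adj x \<xi>) = 1 \<Longrightarrow> int (gdist adj \<xi> y) \<noteq> int (gdist adj x y)"
      using bipartite_gdist_neq[OF dr diam a0, of x \<xi> y] by simp
    show "of_nat (card {\<xi>. int (gdist adj x \<xi>) = 1 \<and> int (gdist adj \<xi> y) = int (gdist adj x y) - 1})
        = h * qdiff (2 * int (gdist adj x y)) / qsum (int D - 2 * int (gdist adj x y))"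
      using card_closer_eq_c_num[OF dr diam, of x y] assms(14) le_D[of x y]
      by (simp add: h_def qdiff_def qsum_def)
    show "of_nat (card {\<xi>. int (gdist adj x \<xi>) = 1 \<and> int (gdist adj \<xi> y) = int (gdist adj x y) + 1})
        = h * qdiff (2 * (int D - int (gdist adj x y))) / qsum (int D - 2 * int (gdist adj x y))"
      using card_farther_eq_b_num[OF dr diam, of x y] assms(15) le_D[of x y]
      by (simp add: h_def qdiff_def qsum_def right_diff_distrib)
    show "(\<Sum>z\<in>UNIV. h * qdiff (int D - 2 * int (gdist adj x z)) * (h * qdiff (int D - 2 * int (gdist adj z y))))
        = of_nat CARD('a) * (h * qdiff (int D - 2 * int (gdist adj x y)))"
      using dual_eigenvalue_convolution[OF conn assms(8)[unfolded assms(1)] idem, of x y]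
      by (simp only: \<theta>(2)[OF le_D])
    show "cnj (h * qdiff (int D - 2 * int (gdist adj x y))) = h * qdiff (int D - 2 * int (gdist adj x y))"
      using real[OF le_D[of x y]] by (simp only: \<theta>(1)[OF le_D])
  qed (use conn assms(1,2) h in auto)
  have c: "\<kappa> / h = 1 / (H * (q powi 2 - q powi (-2)))" "- \<kappa> / h = 1 / (H * (q powi (-2) - q powi 2))"
  proof -
    have "q powi 2 - q powi (-2) = qdiff 2" "q powi (-2) - q powi 2 = - qdiff 2" by (simp_all add: qdiff_def)
    then show "\<kappa> / h = 1 / (H * (q powi 2 - q powi (-2)))" "- \<kappa> / h = 1 / (H * (q powi (-2) - q powi 2))"
      using h_nonzero by (simp_all only: \<kappa>_def) (simp_all add: h_def field_simps)
  qed
  show ?thesis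
    using so6_module[of \<theta>s] \<theta>(2) unfolding c by blast
qed

end
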